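(* Let $T$ be a strongly connected tournament of order $n\ge 9$ whose diameter is not greater than $n-3$. Then for every integer $\ell$ with $6\le \ell\le n-3$ one has $c_{\ell}(T)\ge n-\ell+3$, and, for any such given $\ell$, equality $c_{\ell}(T)=n-\ell+3$ holds if and only if $T$ is isomorphic to $T_{n-3,n}$.
   Context: A tournament of order $n$ is an orientation of the complete graph on $n$ vertices; $v\to w$ means that $(v,w)$ is an arc. A tournament is strongly connected if for any two vertices $v,w$ there is a directed path from $v$ to $w$. The distance from $x$ to $y$ is the length of a shortest directed path from $x$ to $y$, and the diameter is the maximum distance over ordered pairs of distinct vertices. $c_{\ell}(T)$ denotes the number of circuits (directed cycles, without repeated vertices, counted up to the choice of starting vertex) of length $\ell$ in $T$. $T_{n-1,n}(z_0,\dots,z_{n-1})$ denotes the tournament on vertices $z_0,\dots,z_{n-1}$ in which $z_i\to z_{i+1}$ for $0\le i\le n-2$ and $z_j\to z_i$ whenever $j>i+1$. $T_{n-3,n}$ denotes the tournament obtained from $T_{n-1,n}(z_0,\dots,z_{n-1})$ by reversing the two arcs $(z_2,z_0)$ and $(z_{n-1},z_{n-3})$ (so that $z_0\to z_2$ and $z_{n-3}\to z_{n-1}$). *)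

theory Defs
  imports "Graph_Theory.Graph_Theory" "HOL-Library.Extended_Nat"
begin

locale tournament = pair_digraph T for T :: "'a pair_pre_digraph" +
  assumes orientation:
    "\<lbrakk>u \<in> pverts T; v \<in> pverts T; u \<noteq> v\<rbrakk> \<Longrightarrow> (u, v) \<in> parcs T \<longleftrightarrow> (v, u) \<notin> parcs T"

text \<open>Values are in \<^typ>\<open>enat\<close>, so that the distance to an unreachable vertex is infinite.\<close>

definition digraph_dist :: "('a, 'b) pre_digraph \<Rightarrow> 'a \<Rightarrow> 'a \<Rightarrow> enat" where
  "digraph_dist G x y = (INF p \<in> {p. pre_digraph.apath G x p y}. enat (length p))"

definition digraph_diameter :: "('a, 'b) pre_digraph \<Rightarrow> enat" where
  "digraph_diameter G =
    (SUP (x, y) \<in> {(x, y). x \<in> verts G \<and> y \<in> verts G \<and> x \<noteq> y}. digraph_dist G x y)"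

text \<open>
  A cycle of the library is a list of arcs with a distinguished starting vertex; moving that
  vertex along the cycle rotates the list. Circuits are therefore the classes of cycles modulo
  rotation.
\<close>

definition num_circuits :: "nat \<Rightarrow> ('a, 'b) pre_digraph \<Rightarrow> nat" where
  "num_circuits l G =
    card ({p. pre_digraph.cycle G p \<and> length p = l} // {(p, q). \<exists>k. q = rotate k p})"

text \<open>
  The tournaments $T_{n-1,n}$ and $T_{n-3,n}$, with the number \<open>i\<close> as the vertex $z_i$.
  The second one is meant for \<open>n \<ge> 4\<close>, where the two reversed pairs are distinct arcs
  of the first one.
\<close>

definition T_nm1 :: "nat \<Rightarrow> nat pair_pre_digraph" where
  "T_nm1 n = \<lparr> pverts = {..<n}, parcs = {(i, j). i < n \<and> j < n \<and> (j = i + 1 \<or> i > j + 1)} \<rparr>"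

definition reverse_arcs :: "('a \<times> 'a) set \<Rightarrow> 'a pair_pre_digraph \<Rightarrow> 'a pair_pre_digraph" where
  "reverse_arcs R T = T \<lparr> parcs := (parcs T - R) \<union> R\<inverse> \<rparr>"

definition T_nm3 :: "nat \<Rightarrow> nat pair_pre_digraph" where
  "T_nm3 n = reverse_arcs {(2, 0), (n - 1, n - 3)} (T_nm1 n)"

lemma tournament_T_nm1: "tournament (T_nm1 n)"
proof unfold_locales
  show "finite (parcs (T_nm1 n))"
    by (rule finite_subset[of _ "{..<n} \<times> {..<n}"]) (auto simp: T_nm1_def)
qed (auto simp: T_nm1_def)

lemma tournament_T_nm3:
  assumes "n \<ge> 4"
  shows "tournament (T_nm3 n)"
proof unfold_locales
  show "finite (parcs (T_nm3 n))"
    by (rule finite_subset[of _ "{..<n} \<times> {..<n}"])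
      (use assms in \<open>auto simp: T_nm3_def T_nm1_def reverse_arcs_def\<close>)
qed (use assms in \<open>auto simp: T_nm3_def T_nm1_def reverse_arcs_def\<close>)

end

theory Submission
  imports Defs
begin

text \<open>
  Every strong set of \<open>l\<close> vertices carries a Hamiltonian circuit, so the number of circuits of
  length \<open>l\<close> is at least the number of strong \<open>l\<close>-subsets of the vertex set. The lower bound is
  proved for the latter number, by deleting one vertex at a time; write \<open>n\<close> for the order.

  The link between circuits and distances is that a strong tournament with few removable vertices
  (vertices whose deletion leaves a strong tournament) has a large diameter. For each
  non-removable \<open>c\<close> the other vertices split into \<open>A\<close> and \<open>B\<close> with all arcs from \<open>A\<close> to \<open>B\<close>, so that
  every path from \<open>B\<close> to \<open>A\<close> passes through \<open>c\<close>. These splittings order the non-removable vertices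
  linearly, and a path from below the least of them to above the greatest passes through all of
  them (\<open>critical_vertices_far_apart\<close>). So diameter at most \<open>n - 3\<close> forces four
  removable vertices, and only two removable vertices force the tournament $T_{n-1,n}$.

  For \<open>n = l + 2\<close>, counting pairs of deleted vertices gives six strong \<open>l\<close>-subsets, one more
  than the bound \<open>n - l + 3\<close>; the exception is that some vertex can be deleted to leave the path tournament
  $T_{n-2,n-1}$. In that case the diameter forces the deleted vertex to shorten the path, and such a
  shortcut creates four strong \<open>l\<close>-subsets through it (\<open>leaps_attached\<close>), again one too many.
  For \<open>n > l + 2\<close>, delete a removable vertex. If the diameter of the rest is small, the induction
  hypothesis applies. If it is large, the rest consists of a geodesic and one vertex, so the whole
  tournament is a path tournament with two more vertices attached. Each of
  them lies in at least two strong \<open>l\<close>-subsets that avoid the other one, unless it is joined in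
  the same way to the whole path, and together the attached vertices produce one subset too many
  unless they duplicate the two opposite ends of the path (\<open>two_extra_vertices\<close>). The surviving
  tournament is $T_{n-3,n}$, and its circuits of length \<open>l\<close> are listed explicitly
  (\<open>T_nm3_circuit_from_min\<close>), which shows that the bound is attained there.
\<close>

section \<open>Strong vertex sets of a tournament\<close>

text \<open>
  The relation is a tournament on the whole type. A tournament on a vertex set \<open>V\<close> extends to such a
  relation by ordering all other pairs linearly, and then sets of vertices need no membership
  conditions. The tournament under study is a finite set of vertices.
\<close>

locale tournament_relation =
  fixes E :: "'a \<Rightarrow> 'a \<Rightarrow> bool"
  assumes irrefl: "\<not> E x x"
    and total: "x \<noteq> y \<Longrightarrow> E x y \<or> E y x"
    and asym: "E x y \<Longrightarrow> \<not> E y x"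
begin

text \<open>
  Strong connectivity in the form in which it is used: no proper nonempty subset is closed under
  arcs. The empty set and the singletons are strong.
\<close>

definition strong :: "'a set \<Rightarrow> bool" where
  "strong S \<longleftrightarrow> (\<forall>B\<subseteq>S. B \<noteq> {} \<longrightarrow> B \<noteq> S \<longrightarrow> (\<exists>b\<in>B. \<exists>a\<in>S - B. E b a))"

lemma strongD:
  assumes "strong S" "B \<subseteq> S" "B \<noteq> {}" "B \<noteq> S"
  shows "\<exists>b\<in>B. \<exists>a\<in>S - B. E b a"
  using assms unfolding strong_def by blast

lemma strong_closed:
  assumes "strong S" "B \<subseteq> S" "B \<noteq> {}" and "\<And>b a. b \<in> B \<Longrightarrow> a \<in> S \<Longrightarrow> E b a \<Longrightarrow> a \<in> B"
  shows "B = S"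
proof (rule ccontr)
  assume "B \<noteq> S"
  then obtain b a where "b \<in> B" "a \<in> S - B" "E b a" using strongD[OF assms(1-3)] by blast
  then show False using assms(4)[of b a] by blast
qed

lemma strong_nbrs:
  assumes "strong S" "v \<in> S" "S \<noteq> {v}"
  shows "\<exists>a\<in>S - {v}. E v a" and "\<exists>b\<in>S - {v}. E b v"
proof -
  show "\<exists>a\<in>S - {v}. E v a"
    using strongD[OF assms(1), of "{v}"] assms by auto
  show "\<exists>b\<in>S - {v}. E b v"
    using strongD[OF assms(1), of "S - {v}"] assms by auto
qed

text \<open>
  Adding an ear that leaves \<open>U\<close> at \<open>b\<close>, visits two new vertices and returns to \<open>U\<close> at \<open>c\<close>.
\<close>

lemma strong_ear:
  assumes U: "strong U" and bU: "b \<in> U" and cU: "c \<in> U"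
    and arcs: "E b v" "E v w" "E w c"
  shows "strong (insert v (insert w U))"
  unfolding strong_def
proof (intro allI impI)
  let ?S = "insert v (insert w U)"
  fix B assume B: "B \<subseteq> ?S" "B \<noteq> {}" "B \<noteq> ?S"
  show "\<exists>b\<in>B. \<exists>a\<in>?S - B. E b a"
  proof (rule ccontr)
    assume "\<not> ?thesis"
    then have cl: "\<And>x y. x \<in> B \<Longrightarrow> y \<in> ?S \<Longrightarrow> E x y \<Longrightarrow> y \<in> B" by blast
    have "c \<in> B"
    proof -
      from B(2) obtain x where "x \<in> B" by blast
      then consider "x \<in> U" | "x = v" | "x = w" using B(1) by blast
      then show ?thesis
      proof cases
        case 1
        have "B \<inter> U = U"
          by (rule strong_closed[OF U]) (use 1 \<open>x \<in> B\<close> cl in auto)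
        then show ?thesis using cU by blast
      qed (use cl arcs \<open>x \<in> B\<close> cU in blast)+
    qed
    have "B \<inter> U = U"
      by (rule strong_closed[OF U]) (use cU \<open>c \<in> B\<close> cl in auto)
    then have "b \<in> B" using bU by blast
    then have "v \<in> B" "w \<in> B" using cl arcs by blast+
    then show False using \<open>B \<inter> U = U\<close> B by blast
  qed
qed

lemma strong_insert:
  assumes "strong U" "b \<in> U" "c \<in> U" "E b v" "E v c"
  shows "strong (insert v U)"
proof -
  have "strong (insert v (insert c U))"
  proof (cases "U = {b}")
    case True
    then show ?thesis using assms asym by auto
  next
    case False
    obtain d where "d \<in> U" "E c d"
      using strong_nbrs(1)[OF assms(1,3)] assms asym False by blast
    then show ?thesis using strong_ear[OF assms(1,2) \<open>d \<in> U\<close> assms(4,5)] by blast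
  qed
  then show ?thesis using assms(3) by (simp add: insert_absorb)
qed

section \<open>Removable vertices and distances\<close>

definition removable :: "'a set \<Rightarrow> 'a set" where
  "removable S = {v \<in> S. strong (S - {v})}"

text \<open>
  A witness that deleting \<open>c\<close> destroys strong connectivity: paths from \<open>B\<close> to \<open>A\<close> must use \<open>c\<close>.
\<close>

definition cut :: "'a set \<Rightarrow> 'a \<Rightarrow> 'a set \<Rightarrow> 'a set \<Rightarrow> bool" where
  "cut S c A B \<longleftrightarrow> c \<in> S \<and> A \<noteq> {} \<and> B \<noteq> {} \<and> A \<inter> B = {} \<and> A \<union> B = S - {c} \<and>
     (\<forall>a\<in>A. \<forall>b\<in>B. E a b)"

lemma cut_exists:
  assumes "c \<in> S" "c \<notin> removable S"
  shows "\<exists>A B. cut S c A B"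
proof -
  from assms obtain B where B: "B \<subseteq> S - {c}" "B \<noteq> {}" "B \<noteq> S - {c}"
    "\<And>b a. b \<in> B \<Longrightarrow> a \<in> S - {c} - B \<Longrightarrow> \<not> E b a"
    unfolding removable_def strong_def by blast
  have "cut S c (S - {c} - B) B"
    unfolding cut_def
  proof (intro conjI ballI)
    fix a b assume ab: "a \<in> S - {c} - B" "b \<in> B"
    then have "a \<noteq> b" by blast
    then show "E a b" using B(4)[OF ab(2,1)] total by blast
  qed (use B assms(1) in auto)
  then show ?thesis by blast
qed

lemma cutD:
  assumes "cut S c A B"
  shows "c \<in> S" "c \<notin> A" "c \<notin> B" "A \<subseteq> S" "B \<subseteq> S" "A \<inter> B = {}" "A \<noteq> {}" "B \<noteq> {}"
    "\<And>x. x \<in> S \<Longrightarrow> x = c \<or> x \<in> A \<or> x \<in> B"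
    "\<And>a b. a \<in> A \<Longrightarrow> b \<in> B \<Longrightarrow> E a b"
    "\<And>a b. a \<in> A \<Longrightarrow> b \<in> B \<Longrightarrow> \<not> E b a"
proof -
  note h = assms[unfolded cut_def]
  have AB: "A \<union> B = S - {c}" using h by blast
  show "c \<in> S" "A \<inter> B = {}" "A \<noteq> {}" "B \<noteq> {}" using h by blast+
  show "c \<notin> A" "c \<notin> B" "A \<subseteq> S" "B \<subseteq> S" using AB by blast+
  show "x = c \<or> x \<in> A \<or> x \<in> B" if "x \<in> S" for x using AB that by blast
  show "E a b" if "a \<in> A" "b \<in> B" for a b using h that by blast
  then show "\<not> E b a" if "a \<in> A" "b \<in> B" for a b using that asym by blast
qed

lemma cut_leave:
  assumes "cut S c A B" "b \<in> B" "a \<in> S" "E b a"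
  shows "a = c \<or> a \<in> B"
  using cutD(9)[OF assms(1,3)] cutD(11)[OF assms(1) _ assms(2)] assms(4) by blast

lemma cut_enter:
  assumes "cut S c A B" "a \<in> A" "b \<in> S" "E b a"
  shows "b = c \<or> b \<in> A"
  using cutD(9)[OF assms(1,3)] cutD(11)[OF assms(1,2)] assms(4) by blast

text \<open>
  Of two non-removable vertices, one lies above the other, and both cuts agree about which. If each
  lay above the other, then \<open>B \<inter> B'\<close> would be closed under arcs, hence empty. Then \<open>B \<subseteq> A'\<close> and
  \<open>B' \<subseteq> A\<close>, so every arc between \<open>B\<close> and \<open>B'\<close> would have to point in both directions.
\<close>

lemma cut_above:
  assumes S: "strong S" and u: "cut S u A B" and v: "cut S v A' B'" and "v \<in> A"
  shows "u \<in> B'"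
proof (rule ccontr)
  assume "u \<notin> B'"
  then have uA: "u \<in> A'" using cutD(9)[OF v cutD(1)[OF u]] cutD(2)[OF u] \<open>v \<in> A\<close> by blast
  have empty: "B \<inter> B' = {}"
  proof (rule ccontr)
    assume "B \<inter> B' \<noteq> {}"
    have "B \<inter> B' = S"
    proof (rule strong_closed[OF S _ \<open>B \<inter> B' \<noteq> {}\<close>])
      fix b a assume "b \<in> B \<inter> B'" "a \<in> S" "E b a"
      then have "a = u \<or> a \<in> B" "a = v \<or> a \<in> B'"
        using cut_leave[OF u] cut_leave[OF v] by blast+
      then show "a \<in> B \<inter> B'"
        using uA \<open>v \<in> A\<close> cutD(2,6)[OF u] cutD(2,6)[OF v] \<open>b \<in> B \<inter> B'\<close> \<open>E b a\<close> cutD(11)[OF u] cutD(11)[OF v] by blast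
    qed (use cutD[OF u] in blast)
    then show False using cutD(1,3)[OF u] by blast
  qed
  obtain b b' where b: "b \<in> B" "b' \<in> B'" using cutD(8)[OF u] cutD(8)[OF v] by blast
  have "b \<in> A'" using b empty cutD(9)[OF v, of b] cutD(5,6)[OF u] \<open>v \<in> A\<close> by blast
  moreover have "b' \<in> A" using b empty cutD(9)[OF u, of b'] cutD(5,6)[OF v] uA by blast
  ultimately show False using b cutD(10)[OF u] cutD(11)[OF v] by blast
qed

text \<open>
  The mirror image of the previous argument, with \<open>A \<inter> A'\<close> closed under arcs backwards.
\<close>

lemma cut_below:
  assumes S: "strong S" and u: "cut S u A B" and v: "cut S v A' B'" and "v \<in> B"
  shows "u \<in> A'"
proof (rule ccontr)
  assume "u \<notin> A'"
  then have uB: "u \<in> B'" using cutD(9)[OF v cutD(1)[OF u]] cutD(3)[OF u] \<open>v \<in> B\<close> by blast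
  have empty: "A \<inter> A' = {}"
  proof (rule ccontr)
    assume "A \<inter> A' \<noteq> {}"
    then obtain x where x: "x \<in> A \<inter> A'" by blast
    have "S - A \<inter> A' = S"
    proof (rule strong_closed[OF S])
      fix b a assume h: "b \<in> S - A \<inter> A'" "a \<in> S" "E b a"
      show "a \<in> S - A \<inter> A'"
      proof (rule ccontr)
        assume "a \<notin> S - A \<inter> A'"
        then have a: "a \<in> A" "a \<in> A'" using h by auto
        then have "b = u \<or> b \<in> A" "b = v \<or> b \<in> A'"
          using h cut_enter[OF u] cut_enter[OF v] by blast+
        then show False using h a uB \<open>v \<in> B\<close> cutD(11)[OF u] cutD(11)[OF v] by blast
      qed
    qed (use cutD(1,2)[OF u] in blast)+
    then show False using x cutD(4)[OF u] by blast
  qed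
  obtain a a' where a: "a \<in> A" "a' \<in> A'" using cutD(7)[OF u] cutD(7)[OF v] by blast
  have "a \<in> B'" using a empty cutD(9)[OF v, of a] cutD(4,6)[OF u] \<open>v \<in> B\<close> by blast
  moreover have "a' \<in> B" using a empty cutD(9)[OF u, of a'] cutD(4,6)[OF v] uB by blast
  ultimately show False using a cutD(10)[OF u] cutD(11)[OF v] by blast
qed

text \<open>
  This makes the order on the non-removable vertices transitive. In a cyclic triple, the common part of
  the three sets \<open>B\<close> and that of the three sets \<open>A\<close> are closed, hence empty, so a fourth vertex is
  above some of the three and below others. Going around the cycle, it then lies above one of them
  and below the next, and its arc to the third one gets both directions.
\<close>

lemma cuts_acyclic:
  assumes S: "strong S" "finite S" "card S \<ge> 4"
    and u: "cut S u A\<^sub>u B\<^sub>u" and v: "cut S v A\<^sub>v B\<^sub>v" and w: "cut S w A\<^sub>w B\<^sub>w"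
    and cyc: "v \<in> A\<^sub>u" "w \<in> A\<^sub>v" "u \<in> A\<^sub>w"
  shows False
proof -
  have below: "u \<in> B\<^sub>v" "v \<in> B\<^sub>w" "w \<in> B\<^sub>u"
    using cut_above[OF S(1)] u v w cyc by blast+
  note U = cutD[OF u] and V = cutD[OF v] and W = cutD[OF w]
  have "B\<^sub>u \<inter> B\<^sub>v \<inter> B\<^sub>w = {}"
  proof (rule ccontr)
    assume ne: "\<not> ?thesis"
    have "B\<^sub>u \<inter> B\<^sub>v \<inter> B\<^sub>w = S"
    proof (rule strong_closed[OF S(1) _ ne])
      fix b a assume h: "b \<in> B\<^sub>u \<inter> B\<^sub>v \<inter> B\<^sub>w" "a \<in> S" "E b a"
      then have "a = u \<or> a \<in> B\<^sub>u" "a = v \<or> a \<in> B\<^sub>v" "a = w \<or> a \<in> B\<^sub>w"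
        using cut_leave[OF u] cut_leave[OF v] cut_leave[OF w] by blast+
      then show "a \<in> B\<^sub>u \<inter> B\<^sub>v \<inter> B\<^sub>w" using cyc below U(6) V(6) W(6) by blast
    qed (use U in blast)
    then show False using U(1,3) by blast
  qed
  moreover have "A\<^sub>u \<inter> A\<^sub>v \<inter> A\<^sub>w = {}"
  proof (rule ccontr)
    assume ne: "\<not> ?thesis"
    have "S - A\<^sub>u \<inter> A\<^sub>v \<inter> A\<^sub>w = S"
    proof (rule strong_closed[OF S(1)])
      fix b a assume h: "b \<in> S - A\<^sub>u \<inter> A\<^sub>v \<inter> A\<^sub>w" "a \<in> S" "E b a"
      show "a \<in> S - A\<^sub>u \<inter> A\<^sub>v \<inter> A\<^sub>w"
      proof (rule ccontr)
        assume "a \<notin> S - A\<^sub>u \<inter> A\<^sub>v \<inter> A\<^sub>w"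
        then have "a \<in> A\<^sub>u" "a \<in> A\<^sub>v" "a \<in> A\<^sub>w" using h by auto
        then have "b = u \<or> b \<in> A\<^sub>u" "b = v \<or> b \<in> A\<^sub>v" "b = w \<or> b \<in> A\<^sub>w"
          using h(2,3) cut_enter[OF u _ _ h(3)] cut_enter[OF v _ _ h(3)]
            cut_enter[OF w _ _ h(3)] h(1) by blast+
        then show False using h(1) cyc below U(6) V(6) W(6) by blast
      qed
    qed (use U(1,2) in blast)+
    then show False using ne U(4) by blast
  qed
  moreover have "\<exists>z\<in>S. z \<noteq> u \<and> z \<noteq> v \<and> z \<noteq> w"
  proof (rule ccontr)
    assume "\<not> ?thesis"
    then have "S \<subseteq> {u, v, w}" by blast
    then have "card S \<le> card {u, v, w}" by (intro card_mono) auto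
    also have "\<dots> \<le> 3" by (simp add: card_insert_if)
    finally show False using S(3) by simp
  qed
  then obtain z where z: "z \<in> S" "z \<noteq> u" "z \<noteq> v" "z \<noteq> w" by blast
  have "z \<in> A\<^sub>u \<or> z \<in> B\<^sub>u" "z \<in> A\<^sub>v \<or> z \<in> B\<^sub>v" "z \<in> A\<^sub>w \<or> z \<in> B\<^sub>w"
    using U(9) V(9) W(9) z by blast+
  \<comment> \<open>the first one: \<open>w \<in> B\<^sub>u\<close> would give an arc from \<open>z\<close> to \<open>w\<close>, and \<open>w \<in> A\<^sub>v\<close> the opposite one\<close>
  moreover have "\<not> (z \<in> A\<^sub>u \<and> z \<in> B\<^sub>v)" "\<not> (z \<in> A\<^sub>v \<and> z \<in> B\<^sub>w)" "\<not> (z \<in> A\<^sub>w \<and> z \<in> B\<^sub>u)"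
    using U(10) V(10) W(10) cyc below asym by blast+
  ultimately show False by blast
qed

text \<open>
  The vertices at distance at most \<open>k\<close> from \<open>x\<close> inside \<open>S\<close>.
\<close>

primrec reach :: "'a set \<Rightarrow> 'a \<Rightarrow> nat \<Rightarrow> 'a set" where
  "reach S x 0 = {x}"
| "reach S x (Suc k) = reach S x k \<union> {b \<in> S. \<exists>a\<in>reach S x k. E a b}"

text \<open>
  Lower bounds for distances are obtained from potentials that grow by at most one along each arc.
\<close>

lemma reach_potential:
  fixes f :: "'a \<Rightarrow> nat"
  assumes "\<And>a b. a \<in> S \<Longrightarrow> b \<in> S \<Longrightarrow> E a b \<Longrightarrow> f b \<le> f a + 1" and "x \<in> S"
  shows "y \<in> reach S x k \<Longrightarrow> y \<in> S \<and> f y \<le> f x + k"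
proof (induction k arbitrary: y)
  case 0
  then show ?case using assms(2) by simp
next
  case (Suc k)
  then consider "y \<in> reach S x k" | a where "y \<in> S" "a \<in> reach S x k" "E a y" by auto
  then show ?case
  proof cases
    case 2
    then show ?thesis using Suc.IH[of a] assms(1)[of a y] by fastforce
  next
    case 1
    show ?thesis using Suc.IH[OF 1] by simp
  qed
qed

lemma linear_least:
  assumes "finite C" "C \<noteq> {}"
    and "\<And>u v. u \<in> C \<Longrightarrow> v \<in> C \<Longrightarrow> u \<noteq> v \<Longrightarrow> r u v \<or> r v u"
    and "\<And>u v w. u \<in> C \<Longrightarrow> v \<in> C \<Longrightarrow> w \<in> C \<Longrightarrow> r u v \<Longrightarrow> r v w \<Longrightarrow> r u w"
  shows "\<exists>m\<in>C. \<forall>c\<in>C. c \<noteq> m \<longrightarrow> r m c"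
  using assms
proof (induction C rule: finite_ne_induct)
  case (insert x F)
  have "\<exists>m\<in>F. \<forall>c\<in>F. c \<noteq> m \<longrightarrow> r m c"
    by (rule insert.IH) (use insert.prems(1) in blast, use insert.prems(2) in blast)
  then obtain m where m: "m \<in> F" "\<forall>c\<in>F. c \<noteq> m \<longrightarrow> r m c" by blast
  then have "m \<noteq> x" using insert.hyps by blast
  then consider "r m x" | "r x m" using insert.prems(1)[of m x] m by blast
  then show ?case
  proof cases
    case 2
    have "r x c" if "c \<in> F" for c
      using m 2 insert.prems(2)[of x m c] that by (cases "c = m") auto
    then show ?thesis by blast
  qed (use m in auto)
next
  case (singleton x)
  show ?case by simp
qed

text \<open>
  Let \<open>p\<close> and \<open>q\<close> be the least and the greatest of the \<open>m\<close> non-removable vertices. A vertex that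
  reaches the rest only through \<open>p\<close> and a vertex that is reached only through \<open>q\<close> have distance
  greater than \<open>m\<close>, because a path between them meets all \<open>m\<close> non-removable vertices. In terms
  of potentials: the number of non-removable vertices that a path has passed grows only at these vertices.
\<close>

lemma critical_vertices_far_apart:
  assumes S: "strong S" "finite S" "card S \<ge> 4" and few: "card (removable S) + 3 \<le> card S"
  shows "\<exists>x\<in>S. \<exists>y\<in>S. y \<notin> reach S x (card S - card (removable S))"
proof -
  define C where "C = S - removable S"
  have rS: "removable S \<subseteq> S" unfolding removable_def by blast
  have cC: "card C = card S - card (removable S)"
    unfolding C_def using S(2) rS by (simp add: card_Diff_subset finite_subset)
  have C3: "card C \<ge> 3" and finC: "finite C" and CS: "C \<subseteq> S"
    using few cC S(2) C_def by auto
  have "\<forall>c\<in>C. \<exists>A B. cut S c A B" using cut_exists C_def by blast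
  then obtain A B where cut: "\<And>c. c \<in> C \<Longrightarrow> cut S c (A c) (B c)" by metis
  have sym: "u \<in> B v" if "u \<in> C" "v \<in> C" "v \<in> A u" for u v
    using cut_above[OF S(1) cut cut] that by blast
  have sym': "u \<in> A v" if "u \<in> C" "v \<in> C" "v \<in> B u" for u v
    using cut_below[OF S(1) cut cut] that by blast
  have tot: "v \<in> A u \<or> u \<in> A v" if "u \<in> C" "v \<in> C" "u \<noteq> v" for u v
    using cutD(9)[OF cut[OF that(1)], of v] that CS sym' by blast
  have anti: "u \<notin> A v" if "u \<in> C" "v \<in> C" "v \<in> A u" for u v
    using sym[OF that] cutD(6)[OF cut[OF that(2)]] by blast
  have trans: "w \<in> A u" if "u \<in> C" "v \<in> C" "w \<in> C" "v \<in> A u" "w \<in> A v" for u v w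
  proof -
    have "u \<notin> A w"
      using cuts_acyclic[OF S cut[OF that(1)] cut[OF that(2)] cut[OF that(3)]] that by blast
    moreover have "u \<noteq> w" using anti that by blast
    ultimately show ?thesis using tot that by blast
  qed
  have Cne: "C \<noteq> {}" using C3 by auto
  have "\<exists>p\<in>C. \<forall>c\<in>C. c \<noteq> p \<longrightarrow> c \<in> A p"
    by (rule linear_least[OF finC Cne]) (use tot in blast, use trans in blast)
  then obtain p where p: "p \<in> C" "\<And>c. c \<in> C \<Longrightarrow> c \<noteq> p \<Longrightarrow> c \<in> A p" by blast
  have "\<exists>q\<in>C. \<forall>c\<in>C. c \<noteq> q \<longrightarrow> q \<in> A c"
    by (rule linear_least[OF finC Cne]) (use tot in blast, use trans in blast)
  then obtain q where q: "q \<in> C" "\<And>c. c \<in> C \<Longrightarrow> c \<noteq> q \<Longrightarrow> q \<in> A c" by blast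
  have "\<not> C \<subseteq> {p, q}"
  proof
    assume "C \<subseteq> {p, q}"
    then have "card C \<le> card {p, q}" by (intro card_mono) auto
    also have "\<dots> \<le> 2" by (simp add: card_insert_if)
    finally show False using C3 by simp
  qed
  then obtain w where w: "w \<in> C" "w \<noteq> p" "w \<noteq> q" by blast
  note P = cutD[OF cut[OF p(1)]] and Q = cutD[OF cut[OF q(1)]]
  have pq: "q \<in> A p" using p(2)[OF w(1,2)] q(2)[OF w(1,3)] trans p(1) q(1) w(1) by blast
  have disj: "z \<notin> B p" if "z \<in> A q" for z
    using that P(10)[of w z] Q(10)[of z w] p(2)[OF w(1,2)] sym[OF w(1) q(1) q(2)[OF w(1,3)]] asym
    by blast
  define g where "g z = card {c \<in> C. z = c \<or> z \<in> A c}" for z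
  have gp: "g p = 1"
  proof -
    have "{c \<in> C. p = c \<or> p \<in> A c} = {p}" using p anti by blast
    then show ?thesis unfolding g_def by simp
  qed
  have gq: "g q = card C"
  proof -
    have "{c \<in> C. q = c \<or> q \<in> A c} = C" using q by blast
    then show ?thesis unfolding g_def by simp
  qed
  have gpos: "g z \<ge> 1" if "z \<in> S" "z \<notin> B p" for z
  proof -
    have "p \<in> {c \<in> C. z = c \<or> z \<in> A c}" using P(9)[OF that(1)] that(2) p(1) by blast
    then have "{c \<in> C. z = c \<or> z \<in> A c} \<noteq> {}" by blast
    then show ?thesis unfolding g_def using finC by (simp add: Suc_le_eq card_gt_0_iff)
  qed
  have gstep: "g b \<le> g a + 1" if "a \<in> S" "b \<in> S" "E a b" for a b
  proof -
    have "{c \<in> C. b = c \<or> b \<in> A c} \<subseteq> insert b {c \<in> C. a = c \<or> a \<in> A c}"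
      using cut_leave[OF cut _ that(1)] cut_enter that cutD(9)[OF cut] cutD(11)[OF cut] by blast
    then have "g b \<le> card (insert b {c \<in> C. a = c \<or> a \<in> A c})"
      unfolding g_def using finC by (intro card_mono) auto
    also have "\<dots> \<le> g a + 1" unfolding g_def using finC by (simp add: card_insert_if)
    finally show ?thesis .
  qed
  \<comment> \<open>the potential: the number of non-removable vertices passed so far, with an extra level before
    \<open>p\<close> and one after \<open>q\<close>\<close>
  define f where "f z = (if z \<in> B p then 0 else if z \<in> A q then card C + 1 else g z)" for z
  have fstep: "f b \<le> f a + 1" if ab: "a \<in> S" "b \<in> S" "E a b" for a b
  proof -
    consider "b \<in> B p" | "b \<notin> B p" "a \<in> B p" | "b \<notin> B p" "a \<notin> B p" by blast
    then show ?thesis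
    proof cases
      case 2
      then have "b = p" using P(9,11) ab by blast
      then have "b \<notin> A q" using anti[OF p(1) q(1) pq] by blast
      then show ?thesis using \<open>b = p\<close> gp 2 by (simp add: f_def)
    next
      case 3
      show ?thesis
      proof (cases "b \<in> A q \<and> a \<notin> A q")
        case True
        then have "a = q" using Q(9,11) ab by blast
        then show ?thesis using gq 3 True by (simp add: f_def)
      next
        case False
        have "g b \<le> card C + 1" if "a \<in> A q"
          unfolding g_def using card_mono[OF finC, of "{c \<in> C. b = c \<or> b \<in> A c}"] by auto
        then show ?thesis using 3 False gstep[OF ab] by (auto simp: f_def)
      qed
    qed (simp add: f_def)
  qed
  obtain x y where x: "x \<in> B p" and y: "y \<in> A q" using P(8) Q(7) by blast
  have "f x = 0" "f y = card C + 1" using x y disj by (auto simp: f_def)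
  moreover have "x \<in> S" "y \<in> S" using x y P(5) Q(4) by auto
  moreover have "y \<notin> reach S x (card C)"
  proof
    assume "y \<in> reach S x (card C)"
    then have "f y \<le> f x + card C" using reach_potential[of S f, OF fstep \<open>x \<in> S\<close>] by blast
    then show False using calculation by simp
  qed
  ultimately show ?thesis using cC by auto
qed

section \<open>Geodesics and path tournaments\<close>

lemma reach_mono: "k \<le> m \<Longrightarrow> reach S x k \<subseteq> reach S x m"
proof (induction m)
  case (Suc m)
  then show ?case by (cases "k = Suc m") auto
qed simp

lemma reach_sub: "x \<in> S \<Longrightarrow> reach S x k \<subseteq> S"
  by (induction k) auto

lemma reach_step: "a \<in> reach S x k \<Longrightarrow> b \<in> S \<Longrightarrow> E a b \<Longrightarrow> b \<in> reach S x (Suc k)"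
  by auto

text \<open>
  The vertices \<open>z 0, \<dots>, z (p - 1)\<close> induce the tournament $T_{p-1,p}$.
\<close>

definition path_tournament :: "(nat \<Rightarrow> 'a) \<Rightarrow> nat \<Rightarrow> bool" where
  "path_tournament z p \<longleftrightarrow> inj_on z {..<p} \<and>
     (\<forall>i<p. \<forall>j<p. E (z i) (z j) \<longleftrightarrow> j = Suc i \<or> Suc j < i)"

lemma path_tournamentI:
  assumes inj: "inj_on z {..<p}" and step: "\<And>i. Suc i < p \<Longrightarrow> E (z i) (z (Suc i))"
    and bwd: "\<And>i j. Suc i < j \<Longrightarrow> j < p \<Longrightarrow> E (z j) (z i)"
  shows "path_tournament z p"
  unfolding path_tournament_def
proof (intro conjI allI impI inj)
  fix i j assume ij: "i < p" "j < p"
  consider "j = Suc i" | "Suc j < i" | "i = j" | "i = Suc j" | "Suc i < j" by linarith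
  then show "E (z i) (z j) \<longleftrightarrow> j = Suc i \<or> Suc j < i"
    by cases (use step[of i] step[of j] bwd[of i j] bwd[of j i] ij irrefl asym in auto)
qed

lemma path_tournamentD:
  assumes "path_tournament z p"
  shows "inj_on z {..<p}" and "Suc i < p \<Longrightarrow> E (z i) (z (Suc i))"
    and "Suc i < j \<Longrightarrow> j < p \<Longrightarrow> E (z j) (z i)"
proof -
  note h = assms[unfolded path_tournament_def]
  show "inj_on z {..<p}" using h by (rule conjunct1)
  have iff: "E (z i) (z j) \<longleftrightarrow> j = Suc i \<or> Suc j < i" if "i < p" "j < p" for i j
    using conjunct2[OF h] that by blast
  show "E (z i) (z (Suc i))" if "Suc i < p" using iff[of i "Suc i"] that by simp
  show "E (z j) (z i)" if "Suc i < j" "j < p" using iff[of j i] that by simp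
qed

lemma path_vertex_eq: "path_tournament z p \<Longrightarrow> i < p \<Longrightarrow> j < p \<Longrightarrow> z i = z j \<longleftrightarrow> i = j"
  using inj_on_eq_iff[OF path_tournamentD(1)[of z p], of i j] by simp

lemma card_path: "path_tournament z p \<Longrightarrow> X \<subseteq> {..<p} \<Longrightarrow> card (z ` X) = card X"
  using card_image[OF inj_on_subset[OF path_tournamentD(1)]] .

text \<open>
  The vertices of a shortest path induce a path tournament, because a forward arc that skips a vertex
  would be a shortcut. For the same reason no vertex of \<open>S\<close> leads from \<open>z i\<close> to \<open>z j\<close> in two
  steps with \<open>j > i + 2\<close>.
\<close>

lemma geodesic:
  assumes S: "strong S" and xS: "x \<in> S" and yS: "y \<in> S" and far: "y \<notin> reach S x k"
  obtains z where "path_tournament z (k + 2)" "z ` {..<k + 2} \<subseteq> S"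
    "\<And>w i j. w \<in> S \<Longrightarrow> i < k + 2 \<Longrightarrow> j < k + 2 \<Longrightarrow> E (z i) w \<Longrightarrow> E w (z j) \<Longrightarrow> j \<le> i + 2"
proof -
  define L where "L j = (case j of 0 \<Rightarrow> {x} | Suc i \<Rightarrow> reach S x (Suc i) - reach S x i)" for j
  have LR: "L j \<subseteq> reach S x j" for j unfolding L_def by (cases j) auto
  have Lnot: "v \<notin> reach S x i" if "v \<in> L j" "i < j" for v i j
    using that reach_mono[of i "j - 1" S x] unfolding L_def by (cases j) auto
  have chain: "v \<in> L j \<Longrightarrow> \<exists>z. z j = v \<and> (\<forall>i\<le>j. z i \<in> L i) \<and> (\<forall>i<j. E (z i) (z (Suc i)))" for v j
  proof (induction j arbitrary: v)
    case 0
    then show ?case by (intro exI[of _ "\<lambda>_. v"]) simp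
  next
    case (Suc j)
    then have v: "v \<in> reach S x (Suc j)" "v \<notin> reach S x j" by (auto simp: L_def)
    then obtain a where a: "a \<in> reach S x j" "E a v" "v \<in> S" by auto
    have "a \<in> L j"
    proof (cases j)
      case (Suc i)
      have "a \<notin> reach S x i" using v(2) reach_step[OF _ a(3,2), of x i] Suc by blast
      then show ?thesis using a(1) Suc by (simp add: L_def)
    qed (use a in \<open>simp add: L_def\<close>)
    from Suc.IH[OF this] obtain z where z: "z j = a" "\<forall>i\<le>j. z i \<in> L i" "\<forall>i<j. E (z i) (z (Suc i))"
      by blast
    show ?case
      by (rule exI[of _ "z(Suc j := v)"]) (use z a Suc.prems in \<open>auto simp: le_Suc_eq less_Suc_eq\<close>)
  qed
  \<comment> \<open>an empty layer would make the ball of radius \<open>k\<close> closed under arcs, hence equal to \<open>S\<close>\<close>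
  have "L (Suc k) \<noteq> {}"
  proof
    assume "L (Suc k) = {}"
    then have eq: "reach S x (Suc k) = reach S x k" unfolding L_def by auto
    have "reach S x k = S"
    proof (rule strong_closed[OF S reach_sub[OF xS]])
      show "reach S x k \<noteq> {}" using reach_mono[of 0 k S x] by auto
      show "a \<in> reach S x k" if "b \<in> reach S x k" "a \<in> S" "E b a" for a b
        using reach_step[OF that] unfolding eq .
    qed
    then show False using yS far by simp
  qed
  then obtain v where "v \<in> L (Suc k)" by blast
  from chain[OF this] obtain z
    where z': "\<forall>i\<le>Suc k. z i \<in> L i" "\<forall>i<Suc k. E (z i) (z (Suc i))"
    by blast
  have z: "z i \<in> L i" if "i < k + 2" for i using z'(1) that by simp
  have zE: "E (z i) (z (Suc i))" if "Suc i < k + 2" for i using z'(2) that by simp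
  have zS: "z i \<in> S" if "i < k + 2" for i
    using z[OF that] LR reach_sub[OF xS] by blast
  have zR: "z i \<in> reach S x i" if "i < k + 2" for i
    using z[OF that] LR by blast
  have ne: "z i \<noteq> z j" if "i < j" "j < k + 2" for i j
    using Lnot[OF z[OF that(2)] that(1)] zR[of i] that by auto
  show ?thesis
  proof
    show "path_tournament z (k + 2)"
    proof (rule path_tournamentI)
      show "inj_on z {..<k + 2}"
        unfolding inj_on_def using ne by (metis lessThan_iff linorder_neqE_nat)
      show "E (z i) (z (Suc i))" if "Suc i < k + 2" for i using zE[OF that] .
      show "E (z j) (z i)" if ij: "Suc i < j" "j < k + 2" for i j
      proof (rule ccontr)
        assume "\<not> E (z j) (z i)"
        then have "E (z i) (z j)" using total[OF ne[of i j]] ij by auto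
        then have "z j \<in> reach S x (Suc i)" using reach_step[OF zR zS[OF ij(2)]] ij by auto
        then show False using Lnot[OF z[OF ij(2)] ij(1)] by blast
      qed
    qed
    show "z ` {..<k + 2} \<subseteq> S" using zS by auto
    show "j \<le> i + 2" if "w \<in> S" "i < k + 2" "j < k + 2" "E (z i) w" "E w (z j)" for w i j
    proof (rule ccontr)
      assume far: "\<not> j \<le> i + 2"
      have "w \<in> reach S x (Suc i)" using reach_step[OF zR[OF that(2)] that(1,4)] .
      then have "z j \<in> reach S x (Suc (Suc i))" by (rule reach_step) (use zS that in auto)
      then show False using Lnot[OF z[OF that(3)], of "Suc (Suc i)"] far by simp
    qed
  qed
qed

text \<open>
  Otherwise the geodesic between two vertices that are far apart would have more vertices than \<open>S\<close>.
\<close>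

lemma two_removable:
  assumes "strong S" "finite S" "card S \<ge> 4"
  shows "card (removable S) \<ge> 2"
proof (rule ccontr)
  let ?k = "card S - card (removable S)"
  assume r: "\<not> ?thesis"
  then obtain x y where xy: "x \<in> S" "y \<in> S" "y \<notin> reach S x ?k"
    using critical_vertices_far_apart[OF assms] assms(3) by auto
  obtain z where z: "path_tournament z (?k + 2)" "z ` {..<?k + 2} \<subseteq> S"
    by (rule geodesic[OF assms(1) xy])
  have "card (z ` {..<?k + 2}) = ?k + 2" using card_path[OF z(1)] by simp
  then have "?k + 2 \<le> card S" using card_mono[OF assms(2) z(2)] by simp
  then show False using r assms(3) by linarith
qed

text \<open>
  In the extremal case the geodesic between the two far vertices contains all vertices.
\<close>

lemma removable_le_2_imp_path:
  assumes "strong S" "finite S" "card S \<ge> 5" "card (removable S) \<le> 2"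
  obtains z where "path_tournament z (card S)" "z ` {..<card S} = S"
proof -
  have r: "card (removable S) = 2" using two_removable[OF assms(1,2)] assms by simp
  obtain x y where xy: "x \<in> S" "y \<in> S" "y \<notin> reach S x (card S - 2)"
    using critical_vertices_far_apart[OF assms(1,2)] assms(3) r by auto
  obtain z where z: "path_tournament z (card S - 2 + 2)" "z ` {..<card S - 2 + 2} \<subseteq> S"
    by (rule geodesic[OF assms(1) xy])
  moreover have "card S - 2 + 2 = card S" using assms(3) by simp
  ultimately have p: "path_tournament z (card S)" "z ` {..<card S} \<subseteq> S" by simp_all
  moreover have "z ` {..<card S} = S"
    using card_subset_eq[OF assms(2) p(2)] card_path[OF p(1), of "{..<card S}"] by simp
  ultimately show ?thesis using that by blast
qed

definition diameter_le :: "'a set \<Rightarrow> nat \<Rightarrow> bool" where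
  "diameter_le S d \<longleftrightarrow> (\<forall>x\<in>S. S \<subseteq> reach S x d)"

lemma four_removable:
  assumes "strong S" "finite S" "card S \<ge> 7" "diameter_le S (card S - 3)"
  shows "card (removable S) \<ge> 4"
proof (rule ccontr)
  assume r: "\<not> ?thesis"
  then obtain x y where xy: "x \<in> S" "y \<in> S" "y \<notin> reach S x (card S - card (removable S))"
    using critical_vertices_far_apart[OF assms(1,2)] assms(3) by auto
  then have "y \<notin> reach S x (card S - 3)"
    using r reach_mono[of "card S - 3" "card S - card (removable S)" S x] by fastforce
  then show False using assms(4) xy unfolding diameter_le_def by blast
qed

lemma strong_singleton: "strong {a}"
  unfolding strong_def by blast

text \<open>
  Three consecutive vertices form a 3-cycle, and each further vertex has an arc from its predecessor
  and an arc to the first vertex.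
\<close>

lemma strong_interval:
  assumes z: "path_tournament z p" and b: "a + 3 \<le> b" "b \<le> p"
  shows "strong (z ` {a..<b})"
  using b
proof (induction b rule: dec_induct)
  case base
  have "strong (insert (z (a + 1)) (insert (z (a + 2)) {z a}))"
    by (rule strong_ear[OF strong_singleton, of "z a" "z a" "z a"])
      (use path_tournamentD(2,3)[OF z] base in auto)
  moreover have "{a..<a + 3} = {a + 1, a + 2, a}" by auto
  ultimately show ?case by simp
next
  case (step b)
  have "strong (insert (z b) (z ` {a..<b}))"
    by (rule strong_insert[of _ "z (b - 1)" "z a"])
      (use step path_tournamentD(2)[OF z, of "b - 1"] path_tournamentD(3)[OF z, of a b] in auto)
  moreover have "{a..<Suc b} = insert b {a..<b}" using step by auto
  ultimately show ?case by simp
qed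

section \<open>Counting strong sets\<close>

definition strong_sets :: "nat \<Rightarrow> 'a set \<Rightarrow> 'a set set" where
  "strong_sets l S = {U. U \<subseteq> S \<and> card U = l \<and> strong U}"

definition through :: "nat \<Rightarrow> 'a set \<Rightarrow> 'a \<Rightarrow> 'a set set" where
  "through l S v = {U \<in> strong_sets l S. v \<in> U}"

lemma finite_strong_sets: "finite S \<Longrightarrow> finite (strong_sets l S)"
  unfolding strong_sets_def by (rule finite_subset[of _ "Pow S"]) auto

lemma finite_through: "finite S \<Longrightarrow> finite (through l S v)"
  unfolding through_def using finite_strong_sets by auto

lemma card_strong_sets_remove:
  assumes "finite S"
  shows "card (strong_sets l S) = card (strong_sets l (S - {v})) + card (through l S v)"
proof -
  have "strong_sets l S = strong_sets l (S - {v}) \<union> through l S v"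
    unfolding strong_sets_def through_def by auto
  moreover have "strong_sets l (S - {v}) \<inter> through l S v = {}"
    unfolding strong_sets_def through_def by auto
  ultimately show ?thesis
    using card_Un_disjoint finite_strong_sets finite_through assms by (metis finite_Diff)
qed

text \<open>
  There are two removable vertices, so one of them differs from \<open>v\<close> and can be deleted.
\<close>

lemma through_nonempty:
  assumes "finite S" "strong S" "v \<in> S" "3 \<le> l" "l \<le> card S"
  shows "card (through l S v) \<ge> 1"
proof -
  have "\<exists>U \<subseteq> S. card U = l \<and> strong U \<and> v \<in> U"
    using assms
  proof (induction "card S" arbitrary: S rule: less_induct)
    case less
    show ?case
    proof (cases "card S = l")
      case False
      then have c: "card S \<ge> 4" using less.prems by simp
      have "\<not> removable S \<subseteq> {v}"
        using two_removable[OF less.prems(2,1) c] card_mono[of "{v}" "removable S"] by auto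
      then obtain u where u: "u \<in> S" "u \<noteq> v" "strong (S - {u})"
        unfolding removable_def by blast
      have "\<exists>U\<subseteq>S - {u}. card U = l \<and> strong U \<and> v \<in> U"
        by (rule less.hyps) (use less.prems u False in \<open>auto simp: card_Diff_singleton card_gt_0_iff\<close>)
      then show ?thesis by blast
    qed (use less.prems in blast)
  qed
  then have "through l S v \<noteq> {}" unfolding through_def strong_sets_def by blast
  then show ?thesis using finite_through[OF assms(1)] by (simp add: Suc_le_eq card_gt_0_iff)
qed

lemma card_strong_sets_path:
  assumes z: "path_tournament z p" and l: "3 \<le> l" "l \<le> p"
  shows "card (strong_sets l (z ` {..<p})) \<ge> p - l + 1"
proof -
  let ?I = "\<lambda>a. z ` {a..<a + l}"
  have sub: "?I ` {..p - l} \<subseteq> strong_sets l (z ` {..<p})"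
  proof
    fix U assume "U \<in> ?I ` {..p - l}"
    then obtain a where "a \<le> p - l" and a2: "U = ?I a" by blast
    then have a: "a + l \<le> p" "U = ?I a" using l by auto
    then have s: "{a..<a + l} \<subseteq> {..<p}" by auto
    show "U \<in> strong_sets l (z ` {..<p})"
      unfolding strong_sets_def
      using a strong_interval[OF z, of a "a + l"] card_path[OF z s] l image_mono[OF s] by simp
  qed
  have "inj_on ?I {..p - l}"
  proof (rule linorder_inj_onI)
    fix a b assume ab: "a < b" "a \<in> {..p - l}" "b \<in> {..p - l}"
    have "z a \<notin> ?I b" using path_vertex_eq[OF z] ab l by auto
    moreover have "z a \<in> ?I a" using l by auto
    ultimately show "?I a \<noteq> ?I b" by metis
  qed auto
  then have "card (?I ` {..p - l}) = p - l + 1" by (simp add: card_image)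
  then show ?thesis
    using card_mono[OF finite_strong_sets sub] by simp
qed

section \<open>One vertex attached to a path tournament\<close>

text \<open>
  The strong sets of size \<open>l\<close> that consist of \<open>u\<close> and vertices of the path, represented by the
  indices of the latter so that they can be told apart by numbers.
\<close>

definition attached :: "nat \<Rightarrow> (nat \<Rightarrow> 'a) \<Rightarrow> nat \<Rightarrow> 'a \<Rightarrow> nat set set" where
  "attached l z p u = {X. X \<subseteq> {..<p} \<and> Suc (card X) = l \<and> strong (insert u (z ` X))}"

lemma finite_attached: "finite (attached l z p u)"
  unfolding attached_def by (rule finite_subset[of _ "Pow {..<p}"]) auto

lemma card_attached_le:
  assumes z: "path_tournament z p" and u: "u \<notin> z ` {..<p}"
    and S: "insert u (z ` {..<p}) \<subseteq> S" "finite S"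
  shows "card (attached l z p u) \<le> card (through l S u)"
proof (rule card_inj_on_le)
  let ?f = "\<lambda>X. insert u (z ` X)"
  show "inj_on ?f (attached l z p u)"
  proof (rule inj_onI)
    fix X Y assume h: "X \<in> attached l z p u" "Y \<in> attached l z p u" "?f X = ?f Y"
    then have XY: "X \<subseteq> {..<p}" "Y \<subseteq> {..<p}" unfolding attached_def by auto
    then have "z ` X = z ` Y" using h(3) u by (metis image_mono insert_ident subsetD)
    then show "X = Y" using inj_on_image_eq_iff[OF path_tournamentD(1)[OF z] XY] by simp
  qed
  show "?f ` attached l z p u \<subseteq> through l S u"
  proof
    fix U assume "U \<in> ?f ` attached l z p u"
    then obtain X where X: "X \<subseteq> {..<p}" "Suc (card X) = l" "strong (insert u (z ` X))" "U = insert u (z ` X)"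
      unfolding attached_def by auto
    have "u \<notin> z ` X" "finite (z ` X)" using u X(1) finite_subset[OF X(1)] by auto
    then have "card U = l" using X card_path[OF z X(1)] by simp
    moreover have "U \<subseteq> S" using X S by auto
    ultimately show "U \<in> through l S u" unfolding through_def strong_sets_def using X by auto
  qed
  show "finite (through l S u)" using finite_through[OF S(2)] .
qed

text \<open>
  Reversing all arcs and the order of the path exchanges the two ends of a path tournament. This halves
  the case distinctions below.
\<close>

lemma dual: "tournament_relation (\<lambda>x y. E y x)"
proof
  show "\<not> E x x" for x by (rule irrefl)
  show "E y x \<or> E x y" if "x \<noteq> y" for x y using total[OF that] by blast
  show "\<not> E x y" if "E y x" for x y by (rule asym[OF that])
qed

lemma dual_strong: "tournament_relation.strong (\<lambda>x y. E y x) S = strong S"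
proof -
  have half: "tournament_relation.strong (\<lambda>x y. R y x) S"
    if R: "tournament_relation R" "tournament_relation (\<lambda>x y. R y x)" "tournament_relation.strong R S"
    for R :: "'a \<Rightarrow> 'a \<Rightarrow> bool"
    unfolding tournament_relation.strong_def[OF R(2)]
  proof (intro allI impI)
    fix B assume B: "B \<subseteq> S" "B \<noteq> {}" "B \<noteq> S"
    then have "S - B \<subseteq> S" "S - B \<noteq> {}" "S - B \<noteq> S" by auto
    then have "\<exists>b\<in>S - B. \<exists>a\<in>S - (S - B). R b a"
      by (rule tournament_relation.strongD[OF R(1,3)])
    then show "\<exists>b\<in>B. \<exists>a\<in>S - B. R a b" by blast
  qed
  show ?thesis
    using half[of E] half[of "\<lambda>x y. E y x"] dual tournament_relation_axioms by blast
qed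

lemma dual_path:
  assumes z: "path_tournament z p"
  shows "tournament_relation.path_tournament (\<lambda>x y. E y x) (\<lambda>i. z (p - 1 - i)) p"
proof -
  interpret d: tournament_relation "\<lambda>x y. E y x" by (rule dual)
  show ?thesis
  proof (rule d.path_tournamentI)
    show "inj_on (\<lambda>i. z (p - 1 - i)) {..<p}"
      by (rule inj_onI) (use path_vertex_eq[OF z] in auto)
    show "E (z (p - 1 - Suc i)) (z (p - 1 - i))" if "Suc i < p" for i
      using path_tournamentD(2)[OF z, of "p - 1 - Suc i"] that by (simp add: Suc_diff_Suc)
    show "E (z (p - 1 - i)) (z (p - 1 - j))" if "Suc i < j" "j < p" for i j
      using path_tournamentD(3)[OF z, of "p - 1 - j" "p - 1 - i"] that by auto
  qed
qed

lemma reflect_image: "(\<lambda>i. p - 1 - i) ` {..<p} = {..<p::nat}"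
proof -
  have "i \<in> (\<lambda>i. p - 1 - i) ` {..<p}" if "i < p" for i
    by (rule image_eqI[of _ _ "p - 1 - i"]) (use that in auto)
  then show ?thesis by auto
qed

lemma dual_attached_le:
  "card (tournament_relation.attached (\<lambda>x y. E y x) l (\<lambda>i. z (p - 1 - i)) p u) \<le> card (attached l z p u)"
proof (rule card_inj_on_le)
  interpret d: tournament_relation "\<lambda>x y. E y x" by (rule dual)
  let ?r = "\<lambda>i. p - 1 - i"
  have inj: "inj_on ?r {..<p}" by (rule inj_onI) auto
  show "inj_on ((`) ?r) (d.attached l (\<lambda>i. z (p - 1 - i)) p u)"
    by (rule inj_onI) (use inj_on_image_eq_iff[OF inj] in \<open>auto simp: d.attached_def\<close>)
  show "(`) ?r ` d.attached l (\<lambda>i. z (p - 1 - i)) p u \<subseteq> attached l z p u"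
  proof
    fix Y assume "Y \<in> (`) ?r ` d.attached l (\<lambda>i. z (p - 1 - i)) p u"
    then obtain X where X: "X \<subseteq> {..<p}" "Suc (card X) = l" "strong (insert u ((\<lambda>i. z (p - 1 - i)) ` X))"
      "Y = ?r ` X"
      unfolding d.attached_def dual_strong by auto
    have "card Y = card X" using X card_image[OF inj_on_subset[OF inj]] by blast
    moreover have "z ` Y = (\<lambda>i. z (p - 1 - i)) ` X" using X by (simp add: image_image)
    moreover have "Y \<subseteq> {..<p}" using X by auto
    ultimately show "Y \<in> attached l z p u" unfolding attached_def using X by simp
  qed
qed (rule finite_attached)

lemma off_path_nbr:
  assumes "u \<notin> z ` {..<p}" "i < p"
  shows "E u (z i) \<longleftrightarrow> \<not> E (z i) u"
proof -
  have "u \<noteq> z i" using assms by auto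
  then show ?thesis using total[of u "z i"] asym[of u "z i"] by blast
qed

text \<open>
  Intervals of the path that contain two consecutive vertices with opposite arcs to \<open>u\<close> become strong
  sets when \<open>u\<close> is added, so such pairs are what has to be found.
\<close>

lemma change_exists:
  fixes P :: "nat \<Rightarrow> bool"
  assumes "c \<le> x" "x < d" "P x" "c \<le> y" "y < d" "\<not> P y"
  shows "\<exists>k. c \<le> k \<and> Suc k < d \<and> P k \<noteq> P (Suc k)"
proof (rule ccontr)
  assume no: "\<not> ?thesis"
  have "c \<le> k \<Longrightarrow> k < d \<Longrightarrow> P k = P c" for k
  proof (induction k rule: nat_induct_at_least[where m = c, case_names base Suc])
    case (Suc k)
    then show ?case using no by simp
  qed simp
  then show False using assms by blast
qed

text \<open>
  If the pair \<open>z k, z (k + 1)\<close> has at least \<open>m\<close> vertices of the path on either side, then at least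
  \<open>m + 1\<close> intervals of length \<open>l - 1\<close> contain it.
\<close>

lemma intervals_attached:
  assumes z: "path_tournament z p" and u: "u \<notin> z ` {..<p}"
    and k: "m \<le> k" "k + m + 2 \<le> p" "m + 3 \<le> l" "l + m \<le> p + 1" "4 \<le> l"
    and ch: "E (z k) u \<noteq> E (z (Suc k)) u"
  shows "(\<lambda>s. {s..<s + (l - 1)}) ` {k + 3 - l..k + 3 - l + m} \<subseteq> attached l z p u"
proof
  fix X assume "X \<in> (\<lambda>s. {s..<s + (l - 1)}) ` {k + 3 - l..k + 3 - l + m}"
  then obtain s where s: "k + 3 - l \<le> s" "s \<le> k + 3 - l + m" "X = {s..<s + (l - 1)}" by auto
  have sk: "s \<le> k" "Suc k < s + (l - 1)" "s + (l - 1) \<le> p" using s k by linarith+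
  have "strong (z ` X)" unfolding s(3) by (rule strong_interval[OF z]) (use sk k in auto)
  moreover have "z k \<in> z ` X" "z (Suc k) \<in> z ` X" using s(3) sk by auto
  moreover have "E u (z k) \<noteq> E (z k) u" "E u (z (Suc k)) \<noteq> E (z (Suc k)) u"
    using off_path_nbr[OF u] sk by auto
  ultimately have "strong (insert u (z ` X))"
    using ch strong_insert[of "z ` X" "z k" "z (Suc k)" u] strong_insert[of "z ` X" "z (Suc k)" "z k" u]
    by blast
  then show "X \<in> attached l z p u" unfolding attached_def using s(3) sk k by auto
qed

lemma inj_intervals: "0 < m \<Longrightarrow> inj_on (\<lambda>s::nat. {s..<s + m}) A"
proof (rule inj_onI)
  fix s t :: nat assume "0 < m" "{s..<s + m} = {t..<t + m}"
  then have "s \<in> {t..<t + m}" "t \<in> {s..<s + m}" by auto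
  then show "s = t" by simp
qed

lemma card_attached_intervals:
  assumes "path_tournament z p" "u \<notin> z ` {..<p}"
    "m \<le> k" "k + m + 2 \<le> p" "m + 3 \<le> l" "l + m \<le> p + 1" "4 \<le> l" "E (z k) u \<noteq> E (z (Suc k)) u"
  shows "Suc m \<le> card (attached l z p u)"
proof -
  have "card ((\<lambda>s. {s..<s + (l - 1)}) ` {k + 3 - l..k + 3 - l + m}) = Suc m"
    using card_image[OF inj_intervals[of "l - 1"]] assms(7) by simp
  then show ?thesis using card_mono[OF finite_attached intervals_attached[OF assms]] by simp
qed

text \<open>
  Two steps through \<open>u\<close> that replace at least three steps of the path: these are the patterns that
  shorten the path.
\<close>

definition leaps :: "(nat \<Rightarrow> 'a) \<Rightarrow> nat \<Rightarrow> 'a \<Rightarrow> bool" where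
  "leaps z p u \<longleftrightarrow> (\<exists>i j. i + 3 \<le> j \<and> j < p \<and> E (z i) u \<and> E u (z j))"

text \<open>
  The leap makes the part of the path between \<open>i\<close> and \<open>y\<close> dispensable: the upper interval is strong,
  and \<open>z a, \<dots>, z i, u\<close> is a path from it back to itself.
\<close>

lemma strong_bypass:
  assumes z: "path_tournament z p" and u: "E (z i) u" "E u (z j)"
    and ij: "a \<le> i" "i + 2 \<le> y" "y \<le> j" "j < b" "y + 3 \<le> b" "b \<le> p"
  shows "strong (insert u (z ` ({a..i} \<union> {y..<b})))"
proof -
  have A: "strong (z ` {y..<b})" by (rule strong_interval[OF z ij(5,6)])
  have "a \<le> i \<Longrightarrow> strong (insert u (z ` ({a..i} \<union> {y..<b})))" for a
  proof (induction a rule: inc_induct[of _ i])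
    case base
    have "E (z (y + 1)) (z i)" by (rule path_tournamentD(3)[OF z]) (use ij in auto)
    then have "strong (insert (z i) (insert u (z ` {y..<b})))"
      using strong_ear[OF A, of "z (y + 1)" "z j" "z i" u] u ij by simp
    then show ?case by (simp add: insert_commute)
  next
    case (step a)
    have "E (z y) (z a)" by (rule path_tournamentD(3)[OF z]) (use ij step in auto)
    moreover have "E (z a) (z (Suc a))" by (rule path_tournamentD(2)[OF z]) (use ij step in auto)
    ultimately have "strong (insert (z a) (insert u (z ` ({Suc a..i} \<union> {y..<b}))))"
      using strong_insert[OF step.IH, of "z y" "z (Suc a)" "z a"] ij step by auto
    moreover have "{a..i} \<union> {y..<b} = insert a ({Suc a..i} \<union> {y..<b})" using step by auto
    ultimately show ?case by (simp add: insert_commute)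
  qed
  then show ?thesis using ij by blast
qed

lemma bypass_attached:
  assumes "path_tournament z p" "E (z i) u" "E u (z j)"
    "a \<le> i" "i + 2 \<le> y" "y \<le> j" "j < b" "y + 3 \<le> b" "b \<le> p" "(i + 1 - a) + (b - y) = l - 1" "0 < l"
  shows "{a..i} \<union> {y..<b} \<in> attached l z p u"
proof -
  have "card ({a..i} \<union> {y..<b}) = (i + 1 - a) + (b - y)"
    using assms by (subst card_Un_disjoint) auto
  then show ?thesis
    unfolding attached_def using strong_bypass[OF assms(1-9)] assms by auto
qed

text \<open>
  Separates the sets obtained by bypassing vertices from the intervals of the path.
\<close>

definition gapped :: "nat set \<Rightarrow> bool" where
  "gapped X \<longleftrightarrow> (\<exists>a b c. a < b \<and> b < c \<and> a \<in> X \<and> b \<notin> X \<and> c \<in> X)"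

text \<open>
  One set that omits \<open>z (i + 1)\<close> and one that omits \<open>z (i + 1)\<close> and \<open>z (i + 2)\<close>. The condition
  \<open>i + 6 \<le> p\<close> leaves enough room above to make the upper interval strong.
\<close>

lemma leap_gapped:
  assumes z: "path_tournament z p" and u: "E (z i) u" "E u (z j)"
    and ij: "i + 3 \<le> j" "j \<le> i + 5" "i + 6 \<le> p" and l: "6 \<le> l" "l < p"
  shows "2 \<le> card {X \<in> attached l z p u. gapped X}"
proof -
  \<comment> \<open>the lengths of the upper intervals; the lower intervals end at \<open>i\<close> and take the remaining indices\<close>
  define t1 where "t1 = min (p - i - 2) (l - 2)"
  define t2 where "t2 = min (p - i - 3) (l - 2)"
  let ?X1 = "{i + 1 - (l - 1 - t1)..i} \<union> {i + 2..<i + 2 + t1}"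
  let ?X2 = "{i + 1 - (l - 1 - t2)..i} \<union> {i + 3..<i + 3 + t2}"
  have t1: "4 \<le> t1" "t1 \<le> p - i - 2" "t1 + 1 \<le> l - 1" "l - 1 - t1 \<le> i + 1"
    unfolding t1_def using ij l by auto
  have t2: "3 \<le> t2" "t2 \<le> p - i - 3" "t2 + 1 \<le> l - 1" "l - 1 - t2 \<le> i + 1"
    unfolding t2_def using ij l by auto
  have 1: "?X1 \<in> attached l z p u"
    by (rule bypass_attached[OF z u]) (use t1 ij l in auto)
  have 2: "?X2 \<in> attached l z p u"
    by (rule bypass_attached[OF z u]) (use t2 ij l in auto)
  have "gapped ?X1" unfolding gapped_def
    by (intro exI[of _ i] exI[of _ "i + 1"] exI[of _ "i + 2"]) (use t1 in auto)
  moreover have "gapped ?X2" unfolding gapped_def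
    by (intro exI[of _ i] exI[of _ "i + 1"] exI[of _ "i + 3"]) (use t2 in auto)
  moreover have "?X1 \<noteq> ?X2"
  proof -
    have "i + 2 \<in> ?X1" using t1 by auto
    moreover have "i + 2 \<notin> ?X2" by auto
    ultimately show ?thesis by metis
  qed
  ultimately have "card {?X1, ?X2} = 2" "{?X1, ?X2} \<subseteq> {X \<in> attached l z p u. gapped X}"
    using 1 2 by auto
  then show ?thesis using card_mono[of "{X \<in> attached l z p u. gapped X}" "{?X1, ?X2}"] finite_attached by auto
qed

lemma dual_gapped_le:
  "card {X \<in> tournament_relation.attached (\<lambda>x y. E y x) l (\<lambda>i. z (p - 1 - i)) p u. gapped X}
    \<le> card {X \<in> attached l z p u. gapped X}"
proof (rule card_inj_on_le)
  interpret d: tournament_relation "\<lambda>x y. E y x" by (rule dual)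
  let ?r = "\<lambda>i. p - 1 - i" and ?D = "{X \<in> d.attached l (\<lambda>i. z (p - 1 - i)) p u. gapped X}"
  have inj: "inj_on ?r {..<p}" by (rule inj_onI) auto
  show "inj_on ((`) ?r) ?D"
    by (rule inj_onI) (use inj_on_image_eq_iff[OF inj] in \<open>auto simp: d.attached_def\<close>)
  show "(`) ?r ` ?D \<subseteq> {X \<in> attached l z p u. gapped X}"
  proof
    fix Y assume "Y \<in> (`) ?r ` ?D"
    then obtain X where X: "X \<subseteq> {..<p}" "Suc (card X) = l" "strong (insert u ((\<lambda>i. z (p - 1 - i)) ` X))"
      "Y = ?r ` X" and "gapped X"
      unfolding d.attached_def dual_strong by auto
    have "card Y = card X" using X card_image[OF inj_on_subset[OF inj]] by blast
    moreover have "z ` Y = (\<lambda>i. z (p - 1 - i)) ` X" using X by (simp add: image_image)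
    moreover have "Y \<subseteq> {..<p}" using X by auto
    moreover have "gapped Y"
    proof -
      obtain a b c where abc: "a < b" "b < c" "a \<in> X" "b \<notin> X" "c \<in> X"
        using \<open>gapped X\<close> unfolding gapped_def by blast
      have "c < p" using abc X by auto
      moreover have "?r b \<notin> Y"
      proof
        assume "?r b \<in> Y"
        then obtain x where "x \<in> X" "?r b = ?r x" using X by auto
        then have "b = x" using inj_onD[OF inj, of b x] X(1) abc \<open>c < p\<close> by auto
        then show False using \<open>x \<in> X\<close> abc by simp
      qed
      ultimately show ?thesis unfolding gapped_def
        by (intro exI[of _ "?r c"] exI[of _ "?r b"] exI[of _ "?r a"]) (use abc X in auto)
    qed
    ultimately show "Y \<in> {X \<in> attached l z p u. gapped X}" unfolding attached_def using X by simp
  qed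
qed (use finite_attached in simp)

lemma card_four: "a \<noteq> b \<Longrightarrow> a \<noteq> c \<Longrightarrow> a \<noteq> d \<Longrightarrow> b \<noteq> c \<Longrightarrow> b \<noteq> d \<Longrightarrow> c \<noteq> d \<Longrightarrow> card {a, b, c, d} = 4"
  by simp

text \<open>
  The only pattern, up to reversal, with a leap and no change of arcs in the inner part of the path.
  It may lack a second interval, but a set with two separate gaps takes its place.
\<close>

lemma leap_from_start:
  assumes z: "path_tournament z p" and u: "E (z 0) u" "\<And>k. 1 \<le> k \<Longrightarrow> Suc k < p \<Longrightarrow> E u (z k)"
    and l: "6 \<le> l" "l < p"
  shows "4 \<le> card (attached l z p u)"
proof -
  let ?X1 = "{0..<l - 1}" and ?X2 = "{0..0} \<union> {2..<l}" and ?X3 = "{0..0} \<union> {3..<l + 1}"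
    and ?X4 = "insert 2 ({0..0} \<union> {4..<l + 1})"
  have "strong (insert u (z ` ?X1))"
    by (rule strong_insert[OF strong_interval[OF z], of _ _ "z 0" "z 1"]) (use l u(1) u(2)[of 1] in auto)
  then have 1: "?X1 \<in> attached l z p u" unfolding attached_def using l by auto
  have 2: "?X2 \<in> attached l z p u"
    by (rule bypass_attached[OF z u(1) u(2)[of 2]]) (use l in auto)
  have 3: "?X3 \<in> attached l z p u"
    by (rule bypass_attached[OF z u(1) u(2)[of 3]]) (use l in auto)
  have "strong (insert u (z ` ({0..0} \<union> {4..<l + 1})))"
    by (rule strong_bypass[OF z u(1) u(2)[of 4]]) (use l in auto)
  then have "strong (insert (z 2) (insert u (z ` ({0..0} \<union> {4..<l + 1}))))"
    by (rule strong_insert[of _ u "z 0"])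
      (use l u(2)[of 2] path_tournamentD(3)[OF z, of 0 2] in auto)
  then have "strong (insert u (z ` ?X4))" by (simp add: insert_commute)
  moreover have "card ?X4 = l - 1" using l by (simp add: card_insert_if)
  ultimately have 4: "?X4 \<in> attached l z p u" unfolding attached_def using l by auto
  have mem: "1 \<in> ?X1" "1 \<notin> ?X2" "1 \<notin> ?X3" "1 \<notin> ?X4" "2 \<in> ?X2" "3 \<in> ?X2" "2 \<notin> ?X3" "2 \<in> ?X4" "3 \<notin> ?X4"
    using l by auto
  have "?X1 \<noteq> ?X2" "?X1 \<noteq> ?X3" "?X1 \<noteq> ?X4" "?X2 \<noteq> ?X3" "?X2 \<noteq> ?X4" "?X3 \<noteq> ?X4"
    using mem by metis+
  then have "card {?X1, ?X2, ?X3, ?X4} = 4" by (rule card_four)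
  moreover have "{?X1, ?X2, ?X3, ?X4} \<subseteq> attached l z p u" using 1 2 3 4 by blast
  then have "card {?X1, ?X2, ?X3, ?X4} \<le> card (attached l z p u)"
    by (rule card_mono[OF finite_attached])
  ultimately show ?thesis by linarith
qed

text \<open>
  Two intervals of the path and two sets that bypass some vertices. A leap of minimal length spans at most
  five steps, hence leaves room at one of the two ends of the path.
\<close>

lemma leaps_attached:
  assumes z: "path_tournament z p" and u: "u \<notin> z ` {..<p}" and lp: "leaps z p u"
    and l: "6 \<le> l" "l < p"
  shows "4 \<le> card (attached l z p u)"
proof -
  interpret d: tournament_relation "\<lambda>x y. E y x" by (rule dual)
  let ?z = "\<lambda>i. z (p - 1 - i)"
  let ?leap = "\<lambda>g. \<exists>i. i + g < p \<and> E (z i) u \<and> E u (z (i + g))"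
  obtain g0 where g0: "3 \<le> g0 \<and> ?leap g0"
    using lp unfolding leaps_def by (metis add.commute add_leD2 le_Suc_ex nat_add_left_cancel_le)
  define g where "g = (LEAST g. 3 \<le> g \<and> ?leap g)"
  have g: "3 \<le> g \<and> ?leap g" unfolding g_def by (rule LeastI[of _ g0]) (rule g0)
  have gmin: "g \<le> g'" if "3 \<le> g'" "?leap g'" for g'
    unfolding g_def by (rule Least_le) (use that in blast)
  obtain i where i: "i + g < p" "E (z i) u" "E u (z (i + g))" using g by blast
  \<comment> \<open>if the leap is longer, then \<open>z (i + 3)\<close> is one end of a shorter leap\<close>
  have g5: "g \<le> 5"
  proof (rule ccontr)
    assume "\<not> g \<le> 5"
    then have g6: "6 \<le> g" by simp
    show False
    proof (cases "E (z (i + 3)) u")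
      case True
      have "?leap (g - 3)" by (rule exI[of _ "i + 3"]) (use i g6 True in simp)
      moreover have "3 \<le> g - 3" using g6 by simp
      ultimately have "g \<le> g - 3" by (intro gmin)
      then show False using g6 by simp
    next
      case False
      then have "E u (z (i + 3))" using off_path_nbr[OF u, of "i + 3"] i g6 by simp
      then have "?leap 3" using i g6 by (intro exI[of _ i]) simp
      then show False using gmin[of 3] g6 by simp
    qed
  qed
  have gap: "2 \<le> card {X \<in> attached l z p u. gapped X}"
  proof (cases "i + 6 \<le> p")
    case True
    then show ?thesis using leap_gapped[OF z i(2,3)] g g5 l by simp
  next
    case False
    have "2 \<le> card {X \<in> d.attached l ?z p u. gapped X}"
      by (rule d.leap_gapped[OF dual_path[OF z], where i = "p - 1 - (i + g)" and j = "p - 1 - i"])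
        (use i g g5 l False in auto)
    then show ?thesis using dual_gapped_le[of l z p u] by linarith
  qed
  show ?thesis
  proof (cases "\<exists>k. 1 \<le> k \<and> Suc k < p - 1 \<and> E (z k) u \<noteq> E (z (Suc k)) u")
    case True
    then obtain k where k: "1 \<le> k" "Suc k < p - 1" "E (z k) u \<noteq> E (z (Suc k)) u" by blast
    let ?I = "(\<lambda>s. {s..<s + (l - 1)}) ` {k + 3 - l..k + 3 - l + 1}"
    let ?G = "{X \<in> attached l z p u. gapped X}"
    have I: "?I \<subseteq> attached l z p u" by (rule intervals_attached[OF z u]) (use k l in auto)
    have "card ?I = 2" using card_image[OF inj_intervals[of "l - 1"]] l by simp
    moreover have "\<not> gapped X" if "X \<in> ?I" for X using that unfolding gapped_def by auto
    then have "?I \<inter> ?G = {}" by blast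
    then have "card (?I \<union> ?G) = card ?I + card ?G"
      by (intro card_Un_disjoint) (use finite_attached in auto)
    moreover have "card (?I \<union> ?G) \<le> card (attached l z p u)"
      by (rule card_mono[OF finite_attached]) (use I in blast)
    ultimately show ?thesis using gap by linarith
  next
    case False
    then have const: "E (z k) u \<longleftrightarrow> E (z k') u" if "1 \<le> k" "k < p - 1" "1 \<le> k'" "k' < p - 1" for k k'
      using change_exists[of 1 k "p - 1" "\<lambda>k. E (z k) u" k'] change_exists[of 1 k' "p - 1" "\<lambda>k. E (z k) u" k] that
      by blast
    show ?thesis
    proof (cases "E (z 1) u")
      case False
      have nE: "\<not> E (z k) u" if "1 \<le> k" "Suc k < p" for k
        using const[of k 1] False that l by simp
      have "\<not> 1 \<le> i" using nE[of i] i g by auto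
      then have "i = 0" by simp
      then have "E (z 0) u" using i by simp
      then show ?thesis
        by (rule leap_from_start[OF z]) (use nE off_path_nbr[OF u] l in auto)
    next
      case True
      have yE: "E (z k) u" if "1 \<le> k" "Suc k < p" for k
        using const[of k 1] True that l by simp
      have "\<not> Suc (i + g) < p" using yE[of "i + g"] i g asym by auto
      then have ig: "i + g = p - 1" using i by simp
      have "E u (z (p - 1))" using i ig by simp
      have "4 \<le> card (d.attached l ?z p u)"
        by (rule d.leap_from_start[OF dual_path[OF z]])
          (use yE \<open>E u (z (p - 1))\<close> l in auto)
      then show ?thesis using dual_attached_le[of l z p u] by linarith
    qed
  qed
qed

text \<open>
  The vertex \<open>u\<close> duplicates \<open>z 0\<close> (\<open>near_start\<close>) or \<open>z (p - 1)\<close> (\<open>near_end\<close>): the arc between the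
  two copies is arbitrary. In the other two definitions \<open>u\<close> prolongs the path at one end.
\<close>

definition near_start :: "(nat \<Rightarrow> 'a) \<Rightarrow> nat \<Rightarrow> 'a \<Rightarrow> bool" where
  "near_start z p u \<longleftrightarrow> E u (z 1) \<and> (\<forall>k. 2 \<le> k \<longrightarrow> k < p \<longrightarrow> E (z k) u)"

definition near_end :: "(nat \<Rightarrow> 'a) \<Rightarrow> nat \<Rightarrow> 'a \<Rightarrow> bool" where
  "near_end z p u \<longleftrightarrow> E (z (p - 2)) u \<and> (\<forall>k. k + 2 < p \<longrightarrow> E u (z k))"

definition extends_start :: "(nat \<Rightarrow> 'a) \<Rightarrow> nat \<Rightarrow> 'a \<Rightarrow> bool" where
  "extends_start z p u \<longleftrightarrow> E u (z 0) \<and> (\<forall>k. 1 \<le> k \<longrightarrow> k < p \<longrightarrow> E (z k) u)"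

definition extends_end :: "(nat \<Rightarrow> 'a) \<Rightarrow> nat \<Rightarrow> 'a \<Rightarrow> bool" where
  "extends_end z p u \<longleftrightarrow> E (z (p - 1)) u \<and> (\<forall>k. k + 1 < p \<longrightarrow> E u (z k))"

lemma const_on:
  assumes "\<not> (\<exists>k. c \<le> k \<and> Suc k < d \<and> E (z k) u \<noteq> E (z (Suc k)) u)"
    "c \<le> k" "k < d" "c \<le> k'" "k' < d"
  shows "E (z k) u \<longleftrightarrow> E (z k') u"
  using change_exists[of c k d "\<lambda>k. E (z k) u" k'] change_exists[of c k' d "\<lambda>k. E (z k) u" k] assms
  by blast

text \<open>
  Without leaps, the arcs between \<open>u\<close> and the path change direction only within a short window. A
  change with two vertices of the path on either side gives three intervals. Failing that, a change
  with one vertex on either side gives two intervals and makes \<open>u\<close> a duplicate of an end. If the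
  only changes are at the very ends, then \<open>u\<close> prolongs the path.
\<close>

lemma no_leap_cases:
  assumes z: "path_tournament z p" and u: "u \<notin> z ` {..<p}" and lp: "\<not> leaps z p u"
    and l: "6 \<le> l" "l < p" and ij: "i < p" "E (z i) u" "j < p" "E u (z j)"
  shows "extends_start z p u \<or> extends_end z p u \<or> 3 \<le> card (attached l z p u) \<or>
    2 \<le> card (attached l z p u) \<and> (near_start z p u \<or> near_end z p u)"
proof -
  note off = off_path_nbr[OF u]
  have nl: "E (z b) u" if "E (z a) u" "a + 3 \<le> b" "b < p" for a b
    using that lp off[of b] unfolding leaps_def by blast
  have nl': "E u (z a)" if "E u (z b)" "a + 3 \<le> b" "b < p" for a b
    using nl[of a b] off[of a] off[of b] that by auto
  let ?ch = "\<lambda>c d. \<exists>k. c \<le> k \<and> Suc k < d \<and> E (z k) u \<noteq> E (z (Suc k)) u"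
  consider "?ch 2 (p - 2)" | "?ch 1 (p - 1)" "\<not> ?ch 2 (p - 2)" | "\<not> ?ch 1 (p - 1)" by blast
  then show ?thesis
  proof cases
    case 1
    then obtain k where "2 \<le> k" "Suc k < p - 2" "E (z k) u \<noteq> E (z (Suc k)) u" by blast
    then have "Suc 2 \<le> card (attached l z p u)"
      by (intro card_attached_intervals[OF z u]) (use l in auto)
    then show ?thesis by simp
  next
    case 2
    then obtain k where "1 \<le> k" "Suc k < p - 1" "E (z k) u \<noteq> E (z (Suc k)) u" by blast
    then have two: "Suc 1 \<le> card (attached l z p u)"
      by (intro card_attached_intervals[OF z u]) (use l in auto)
    note c = const_on[OF 2(2)]
    have not_all: "\<exists>k. 1 \<le> k \<and> k < p - 1 \<and> E (z k) u" "\<exists>k. 1 \<le> k \<and> k < p - 1 \<and> \<not> E (z k) u"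
      using 2(1) by fastforce+
    show ?thesis
    proof (cases "E (z 2) u")
      case True
      have a: "E (z k) u" if "2 \<le> k" "k < p" for k
      proof (cases "k < p - 2")
        case t: True
        then show ?thesis using c[of k 2] that True l by simp
      next
        case False
        then show ?thesis using nl[OF True, of k] that l by simp
      qed
      have "\<not> E (z 1) u"
      proof
        assume "E (z 1) u"
        then have "E (z k) u" if "1 \<le> k" "k < p - 1" for k using a[of k] that by (cases "k = 1") auto
        then show False using not_all by blast
      qed
      then have "near_start z p u" unfolding near_start_def using a off[of 1] l by auto
      then show ?thesis using two by simp
    next
      case False
      then have F: "\<not> E (z (p - 3)) u" using c[of "p - 3" 2] l by simp
      have a: "E u (z k)" if "k < p - 2" for k
      proof (cases "2 \<le> k")
        case t: True
        then show ?thesis using c[of k 2] that False off[of k] l by simp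
      next
        case k: False
        then show ?thesis using nl'[of "p - 3" k] F off[of "p - 3"] that l by simp
      qed
      have "E (z (p - 2)) u"
      proof (rule ccontr)
        assume n: "\<not> E (z (p - 2)) u"
        have "\<not> E (z k) u" if "1 \<le> k" "k < p - 1" for k
          using a[of k] off[of k] n that by (cases "k = p - 2") auto
        then show False using not_all by blast
      qed
      then have "near_end z p u" unfolding near_end_def using a by auto
      then show ?thesis using two by simp
    qed
  next
    case 3
    note c = const_on[OF 3]
    show ?thesis
    proof (cases "E (z 1) u")
      case True
      have a: "E (z k) u" if "1 \<le> k" "k < p" for k
      proof (cases "k < p - 1")
        case t: True
        then show ?thesis using c[of k 1] that True l by simp
      next
        case False
        then show ?thesis using nl[OF True, of k] that l by simp
      qed
      have "j = 0" using a[of j] off[of j] ij by (cases j) auto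
      then have "extends_start z p u" unfolding extends_start_def using a ij by blast
      then show ?thesis by simp
    next
      case False
      then have F: "\<not> E (z (p - 2)) u" using c[of "p - 2" 1] l by simp
      have a: "E u (z k)" if "k < p - 1" for k
      proof (cases "1 \<le> k")
        case t: True
        then show ?thesis using c[of k 1] that False off[of k] l by simp
      next
        case k: False
        then show ?thesis using nl'[of "p - 2" k] F off[of "p - 2"] that l by simp
      qed
      have "i = p - 1" using a[of i] off[of i] ij by (cases "i < p - 1") auto
      then have "extends_end z p u" unfolding extends_end_def using a ij by auto
      then show ?thesis by simp
    qed
  qed
qed

lemma path_cons:
  assumes z: "path_tournament z p" and u: "u \<notin> z ` {..<p}" and e: "extends_start z p u"
  shows "path_tournament (case_nat u z) (Suc p)" "case_nat u z ` {..<Suc p} = insert u (z ` {..<p})"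
proof -
  show "path_tournament (case_nat u z) (Suc p)"
  proof (rule path_tournamentI)
    show "inj_on (case_nat u z) {..<Suc p}"
      by (rule inj_onI) (use u path_vertex_eq[OF z] in \<open>auto split: nat.splits\<close>)
    show "E (case_nat u z i) (case_nat u z (Suc i))" if "Suc i < Suc p" for i
      using that path_tournamentD(2)[OF z] e unfolding extends_start_def by (cases i) auto
    show "E (case_nat u z j) (case_nat u z i)" if "Suc i < j" "j < Suc p" for i j
      using that path_tournamentD(3)[OF z, of "i - 1" "j - 1"] e unfolding extends_start_def
      by (cases i; cases j) auto
  qed
  show "case_nat u z ` {..<Suc p} = insert u (z ` {..<p})"
    by (auto simp: lessThan_Suc_eq_insert_0 image_image)
qed

lemma path_snoc:
  assumes z: "path_tournament z p" and u: "u \<notin> z ` {..<p}" and e: "extends_end z p u"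
  shows "path_tournament (z(p := u)) (Suc p)" "(z(p := u)) ` {..<Suc p} = insert u (z ` {..<p})"
proof -
  show "path_tournament (z(p := u)) (Suc p)"
  proof (rule path_tournamentI)
    have "inj_on z {..<p}" using path_tournamentD(1)[OF z] .
    then show "inj_on (z(p := u)) {..<Suc p}"
      using u unfolding lessThan_Suc by (auto simp: inj_on_def)
    show "E ((z(p := u)) i) ((z(p := u)) (Suc i))" if "Suc i < Suc p" for i
      using that path_tournamentD(2)[OF z, of i] e unfolding extends_end_def
      by (cases "Suc i = p") auto
    show "E ((z(p := u)) j) ((z(p := u)) i)" if "Suc i < j" "j < Suc p" for i j
      using that path_tournamentD(3)[OF z, of i j] e unfolding extends_end_def
      by (cases "j = p") auto
  qed
  show "(z(p := u)) ` {..<Suc p} = insert u (z ` {..<p})"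
    unfolding lessThan_Suc by auto
qed

text \<open>
  The two copies of the first vertex are interchangeable.
\<close>

lemma path_swap_start:
  assumes z: "path_tournament z p" and u: "u \<notin> z ` {..<p}" and e: "near_start z p u"
  shows "path_tournament (z(0 := u)) p"
proof (rule path_tournamentI)
  show "inj_on (z(0 := u)) {..<p}"
    by (rule inj_onI) (use u path_vertex_eq[OF z] in \<open>auto split: if_splits\<close>)
  show "E ((z(0 := u)) i) ((z(0 := u)) (Suc i))" if "Suc i < p" for i
    using that path_tournamentD(2)[OF z, of i] e unfolding near_start_def by (cases i) auto
  show "E ((z(0 := u)) j) ((z(0 := u)) i)" if "Suc i < j" "j < p" for i j
    using that path_tournamentD(3)[OF z, of i j] e unfolding near_start_def by (cases i) auto
qed

text \<open>
  If the remaining vertex did not leap, then the two ends of the path would still be at distance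
  \<open>card S - 2\<close>, as the potential that numbers the path shows.
\<close>

lemma long_path_many_strong_sets:
  assumes S: "finite S" "strong S" "diameter_le S (card S - 3)" and l: "6 \<le> l" "l + 2 \<le> card S"
    and z: "path_tournament z (card S - 1)" and zS: "z ` {..<card S - 1} \<subseteq> S"
  shows "card S - l + 4 \<le> card (strong_sets l S)"
proof -
  let ?p = "card S - 1"
  have "card (S - z ` {..<?p}) = 1"
    using S(1) zS card_path[OF z, of "{..<?p}"] l by (subst card_Diff_subset) auto
  then obtain u where u: "S - z ` {..<?p} = {u}" using card_1_singletonE by blast
  then have uP: "u \<notin> z ` {..<?p}" and Su: "S = insert u (z ` {..<?p})" using zS by auto
  have "leaps z ?p u"
  proof (rule ccontr)
    assume nl: "\<not> leaps z ?p u"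
    have "S \<noteq> {u}" using l by auto
    then obtain b where "b \<in> S - {u}" "E b u" using strong_nbrs(2)[OF S(2), of u] Su by blast
    then have ex: "\<exists>i. i < ?p \<and> E (z i) u" using Su by auto
    \<comment> \<open>without leaps, the arcs from \<open>u\<close> lead at most two positions beyond \<open>lo\<close>\<close>
    define lo where "lo = (LEAST i. i < ?p \<and> E (z i) u)"
    have lo: "lo < ?p \<and> E (z lo) u" unfolding lo_def using ex by (rule LeastI_ex)
    have lo_le: "lo \<le> i" if "i < ?p" "E (z i) u" for i
      unfolding lo_def by (rule Least_le) (use that in blast)
    define f where "f v = (if v = u then Suc lo else the_inv_into {..<?p} z v)" for v
    have fz: "f (z i) = i" if "i < ?p" for i
      using that uP the_inv_into_f_f[OF path_tournamentD(1)[OF z], of i] unfolding f_def by auto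
    have step: "f b \<le> f a + 1" if ab: "a \<in> S" "b \<in> S" "E a b" for a b
    proof (cases "a = u")
      case True
      then have "b \<noteq> u" using ab irrefl by metis
      then obtain j where j: "j < ?p" "b = z j" using ab Su by auto
      have "\<not> lo + 3 \<le> j" using nl lo j ab True unfolding leaps_def by blast
      then show ?thesis using fz j True by (simp add: f_def)
    next
      case False
      then obtain i where i: "i < ?p" "a = z i" using ab Su by auto
      show ?thesis
      proof (cases "b = u")
        case True
        then show ?thesis using lo_le i ab fz by (simp add: f_def)
      next
        case False
        then obtain j where j: "j < ?p" "b = z j" using ab Su by auto
        have "\<not> Suc i < j" using path_tournamentD(3)[OF z, of i j] j i ab asym by auto
        then show ?thesis using fz i j by simp
      qed
    qed
    have mem: "z 0 \<in> S" "z (card S - 2) \<in> S" using zS l by auto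
    then have "z (card S - 2) \<in> reach S (z 0) (card S - 3)" using S(3) unfolding diameter_le_def by blast
    then have "f (z (card S - 2)) \<le> f (z 0) + (card S - 3)"
      using reach_potential[of S f, OF step mem(1)] by blast
    then show False using fz l by simp
  qed
  then have "4 \<le> card (attached l z ?p u)" using leaps_attached[OF z uP] l by simp
  also have "\<dots> \<le> card (through l S u)" by (rule card_attached_le[OF z uP]) (use Su S in auto)
  finally have "4 \<le> card (through l S u)" .
  moreover have "S - {u} = z ` {..<?p}" using Su uP by auto
  then have "?p - l + 1 \<le> card (strong_sets l (S - {u}))" using card_strong_sets_path[OF z] l by simp
  ultimately show ?thesis using card_strong_sets_remove[OF S(1), of l u] l by linarith
qed

section \<open>Two vertices attached to a path tournament\<close>

definition both :: "nat \<Rightarrow> 'a set \<Rightarrow> 'a \<Rightarrow> 'a \<Rightarrow> 'a set set" where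
  "both l S v w = {U \<in> strong_sets l S. v \<in> U \<and> w \<in> U}"

lemma two_extra_vertices_count:
  assumes z: "path_tournament z p" and vw: "v \<notin> z ` {..<p}" "w \<notin> z ` {..<p}" "v \<noteq> w"
    and S: "S = insert v (insert w (z ` {..<p}))" and l: "3 \<le> l" "l \<le> p"
  shows "p - l + 1 + card (attached l z p v) + card (attached l z p w) + card (both l S v w)
    \<le> card (strong_sets l S)"
proof -
  let ?P = "z ` {..<p}"
  have fin: "finite S" using S by simp
  have Sv: "S - {v} = insert w ?P" and Pw: "insert w ?P - {w} = ?P" using S vw by auto
  have "card (attached l z p w) \<le> card (through l (insert w ?P) w)"
    by (rule card_attached_le[OF z vw(2)]) auto
  moreover have "p - l + 1 \<le> card (strong_sets l ?P)" by (rule card_strong_sets_path[OF z l])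
  moreover have "card (attached l z p v) \<le> card (through l (insert v ?P) v)"
    by (rule card_attached_le[OF z vw(1)]) auto
  moreover have "card (through l (insert v ?P) v) + card (both l S v w) \<le> card (through l S v)"
  proof -
    have "through l (insert v ?P) v \<inter> both l S v w = {}"
      unfolding through_def both_def strong_sets_def using vw by auto
    moreover have "through l (insert v ?P) v \<union> both l S v w \<subseteq> through l S v"
      unfolding through_def both_def strong_sets_def using S by auto
    moreover have "finite (both l S v w)" unfolding both_def using finite_strong_sets[OF fin] by simp
    ultimately show ?thesis
      using card_Un_disjoint[of "through l (insert v ?P) v" "both l S v w"] finite_through
        card_mono[OF finite_through[OF fin]] by (metis finite.emptyI finite_imageI finite_insert finite_lessThan)
  qed
  ultimately show ?thesis
    using card_strong_sets_remove[OF fin, of l v] card_strong_sets_remove[of "insert w ?P" l w]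
    unfolding Sv Pw by simp
qed

lemma both_member:
  assumes "path_tournament z p" "v \<notin> z ` {..<p}" "w \<notin> z ` {..<p}" "v \<noteq> w"
    "X \<subseteq> {..<p}" "card X + 2 = l" "strong (insert v (insert w (z ` X)))"
    "insert v (insert w (z ` {..<p})) \<subseteq> S"
  shows "insert v (insert w (z ` X)) \<in> both l S v w"
proof -
  have "finite X" using assms(5) finite_subset by blast
  then have "card (insert v (insert w (z ` X))) = l"
    using assms(2-6) card_path[OF assms(1,5)] by (subst card_insert_disjoint; force simp: card_insert_if)
  moreover have "insert v (insert w (z ` X)) \<subseteq> S" using assms(5,8) by blast
  ultimately show ?thesis unfolding both_def strong_sets_def using assms(7) by simp
qed

lemma both_nonempty:
  assumes "U \<in> both l S v w" "finite S"
  shows "1 \<le> card (both l S v w)"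
proof -
  have "finite (both l S v w)" unfolding both_def using finite_strong_sets[OF assms(2)] by simp
  then show ?thesis using assms(1) by (auto simp: Suc_le_eq card_gt_0_iff)
qed

text \<open>
  The vertex \<open>v\<close>, dominated by the whole path, is useful only together with \<open>w\<close>: an ear from the path
  through \<open>v\<close> and \<open>w\<close> returns to the last vertex \<open>z h\<close> dominated by \<open>w\<close>. If \<open>h < 2\<close>, there is a
  longer path tournament; otherwise the intervals that start at 0, 1 and 2 all contain a vertex
  dominated by \<open>w\<close>, because \<open>w\<close> does not leap and thus dominates \<open>z k\<close> whenever \<open>k + 3 \<le> h\<close>.
\<close>

lemma dominated_extra_vertex:
  assumes z: "path_tournament z p" and vw: "v \<notin> z ` {..<p}" "w \<notin> z ` {..<p}" "v \<noteq> w"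
    and l: "6 \<le> l" "l < p" and v: "\<And>k. k < p \<Longrightarrow> E (z k) v" "E v w"
    and w: "\<not> leaps z p w" "j < p" "E w (z j)"
    and maxp: "\<And>z'. path_tournament z' (Suc p) \<Longrightarrow> \<not> z' ` {..<Suc p} \<subseteq> insert v (insert w (z ` {..<p}))"
  shows "3 \<le> card (both l (insert v (insert w (z ` {..<p}))) v w)"
proof -
  let ?S = "insert v (insert w (z ` {..<p}))"
  note off = off_path_nbr[OF vw(2)]
  define h where "h = Max {j. j < p \<and> E w (z j)}"
  have fin: "finite {j. j < p \<and> E w (z j)}" "{j. j < p \<and> E w (z j)} \<noteq> {}" using w by auto
  have h: "h < p" "E w (z h)" using Max_in[OF fin] unfolding h_def by auto
  have hmax: "E (z k) w" if "h < k" "k < p" for k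
  proof (rule ccontr)
    assume "\<not> E (z k) w"
    then have "k \<in> {j. j < p \<and> E w (z j)}" using off[of k] that by simp
    then have "k \<le> h" unfolding h_def by (rule Max_ge[OF fin(1)])
    then show False using that by simp
  qed
  have low: "E w (z k)" if "k + 3 \<le> h" for k
    using that h w(1) off[of k] unfolding leaps_def by auto
  have h2: "2 \<le> h"
  proof (rule ccontr)
    assume "\<not> 2 \<le> h"
    then consider "h = 0" | "h = 1" by linarith
    then show False
    proof cases
      case 1
      then have "extends_start z p w" unfolding extends_start_def using h hmax by auto
      from path_cons[OF z vw(2) this] show False using maxp by blast
    next
      case 2
      then have "near_start z p w" unfolding near_start_def using h hmax by auto
      from path_swap_start[OF z vw(2) this] have z1: "path_tournament (z(0 := w)) p" .
      have vz1: "v \<notin> (z(0 := w)) ` {..<p}" using vw by auto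
      have "extends_start (z(0 := w)) p v" unfolding extends_start_def using v l by auto
      from path_cons[OF z1 vz1 this] have "path_tournament (case_nat v (z(0 := w))) (Suc p)"
        "case_nat v (z(0 := w)) ` {..<Suc p} = insert v ((z(0 := w)) ` {..<p})" .
      moreover have "insert v ((z(0 := w)) ` {..<p}) \<subseteq> ?S" by auto
      ultimately show False using maxp by metis
    qed
  qed
  let ?U = "\<lambda>s. insert v (insert w (z ` {s..<s + (l - 2)}))"
  have mem: "?U s \<in> both l ?S v w" if s: "s \<le> 2" for s
  proof -
    have "\<exists>c. s \<le> c \<and> c < s + (l - 2) \<and> E w (z c)"
    proof (cases "s + 3 \<le> h")
      case True
      then show ?thesis using low l by (intro exI[of _ s]) auto
    next
      case False
      then show ?thesis using h h2 s l by (intro exI[of _ h]) auto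
    qed
    then obtain c where c: "s \<le> c" "c < s + (l - 2)" "E w (z c)" by blast
    have "strong (?U s)"
      by (rule strong_ear[OF strong_interval[OF z], of _ _ "z s" "z c"]) (use c v s l in auto)
    then show ?thesis by (intro both_member[OF z vw]) (use s l in auto)
  qed
  have neq: "?U s \<noteq> ?U t" if "s < t" "t \<le> 2" for s t
  proof -
    have "z s \<in> ?U s" using l by auto
    moreover have "z s \<notin> ?U t"
      using that path_vertex_eq[OF z] vw l by auto
    ultimately show ?thesis by metis
  qed
  have "card {?U 0, ?U 1, ?U 2} = 3" using neq[of 0 1] neq[of 0 2] neq[of 1 2] by auto
  moreover have "finite (both l ?S v w)" unfolding both_def using finite_strong_sets[of ?S l] by simp
  moreover have "?U 0 \<in> both l ?S v w" "?U 1 \<in> both l ?S v w" "?U 2 \<in> both l ?S v w"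
    by (rule mem, simp)+
  then have "{?U 0, ?U 1, ?U 2} \<subseteq> both l ?S v w" by blast
  ultimately have "card {?U 0, ?U 1, ?U 2} \<le> card (both l ?S v w)" "card {?U 0, ?U 1, ?U 2} = 3"
    by (blast intro: card_mono)+
  then show ?thesis by linarith
qed

text \<open>
  The tournament $T_{n-3,n}$ up to isomorphism: a path tournament whose first vertex is duplicated by
  \<open>v\<close> and whose last vertex is duplicated by \<open>w\<close>.
\<close>

definition twin_ended :: "'a set \<Rightarrow> bool" where
  "twin_ended S \<longleftrightarrow> (\<exists>z v w. path_tournament z (card S - 2) \<and>
     v \<notin> z ` {..<card S - 2} \<and> w \<notin> z ` {..<card S - 2} \<and> v \<noteq> w \<and>
     near_start z (card S - 2) v \<and> near_end z (card S - 2) w \<and> E w v \<and>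
     S = insert v (insert w (z ` {..<card S - 2})))"

lemma dual_both: "tournament_relation.both (\<lambda>x y. E y x) l S v w = both l S v w"
  unfolding tournament_relation.both_def[OF dual] tournament_relation.strong_sets_def[OF dual]
    dual_strong both_def strong_sets_def ..

lemma constant_extra_vertex:
  assumes z: "path_tournament z p" and vw: "v \<notin> z ` {..<p}" "w \<notin> z ` {..<p}" "v \<noteq> w"
    and S: "strong S" "S = insert v (insert w (z ` {..<p}))"
    and l: "6 \<le> l" "l < p"
    and v: "(\<forall>k<p. E (z k) v) \<or> (\<forall>k<p. E v (z k))"
    and w: "\<not> leaps z p w" "i < p" "E (z i) w" "j < p" "E w (z j)"
    and maxp: "\<And>z'. path_tournament z' (Suc p) \<Longrightarrow> \<not> z' ` {..<Suc p} \<subseteq> S"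
  shows "3 \<le> card (both l S v w)"
  using v
proof
  assume v: "\<forall>k<p. E (z k) v"
  have "S \<noteq> {v}" using S(2) vw by auto
  then obtain a where "a \<in> S - {v}" "E v a" using strong_nbrs(1)[OF S(1), of v] S(2) by blast
  then have "E v w" using S(2) v asym by blast
  then show ?thesis
    using dominated_extra_vertex[OF z vw l _ _ w(1,4,5)] v maxp S(2) by blast
next
  assume v: "\<forall>k<p. E v (z k)"
  interpret d: tournament_relation "\<lambda>x y. E y x" by (rule dual)
  let ?z = "\<lambda>i. z (p - 1 - i)"
  have img: "?z ` {..<p} = z ` {..<p}" using reflect_image[of p] image_image[of z "\<lambda>i. p - 1 - i"] by metis
  have "S \<noteq> {v}" using S(2) vw by auto
  then obtain a where "a \<in> S - {v}" "E a v" using strong_nbrs(2)[OF S(1), of v] S(2) by blast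
  then have wv: "E w v" using S(2) v asym by blast
  have "3 \<le> card (d.both l (insert v (insert w (?z ` {..<p}))) v w)"
  proof (rule d.dominated_extra_vertex[OF dual_path[OF z] _ _ vw(3) l])
    show "v \<notin> ?z ` {..<p}" "w \<notin> ?z ` {..<p}" unfolding img by (fact vw)+
    show "E v (z (p - 1 - k))" if "k < p" for k using v that by auto
    show "E w v" by (fact wv)
    show "\<not> d.leaps ?z p w"
    proof
      assume "d.leaps ?z p w"
      then obtain i j where "i + 3 \<le> j" "j < p" "E w (z (p - 1 - i))" "E (z (p - 1 - j)) w"
        unfolding d.leaps_def by blast
      then have "leaps z p w" unfolding leaps_def
        by (intro exI[of _ "p - 1 - j"] exI[of _ "p - 1 - i"]) auto
      then show False using w by blast
    qed
    show "p - 1 - i < p" "E (z (p - 1 - (p - 1 - i))) w" using w by auto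
    fix z' assume "d.path_tournament z' (Suc p)"
    from d.dual_path[OF this] have "path_tournament (\<lambda>i. z' (Suc p - 1 - i)) (Suc p)" .
    moreover have "(\<lambda>i. z' (Suc p - 1 - i)) ` {..<Suc p} = z' ` {..<Suc p}"
      using reflect_image[of "Suc p"] image_image[of z' "\<lambda>i. Suc p - 1 - i"] by metis
    ultimately have "\<not> z' ` {..<Suc p} \<subseteq> S" using maxp by metis
    then show "\<not> z' ` {..<Suc p} \<subseteq> insert v (insert w (?z ` {..<p}))"
      unfolding img S(2)[symmetric] .
  qed
  then show ?thesis unfolding img S(2)[symmetric] dual_both .
qed

text \<open>
  The path contributes \<open>card S - l - 1\<close> intervals, so four further strong sets give the bound and a fifth
  one makes it strict. Each attached vertex that is not constant on the path contributes two by itself,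
  and three or more unless it duplicates an end. Two duplicates of the same end lie together in one more strong
  set, and so do duplicates of opposite ends if there is an arc from the first end to the last one.
  What remains is \<open>twin_ended\<close>.
\<close>

lemma two_extra_vertices:
  assumes fin: "finite S" and S: "strong S" "S = insert v (insert w (z ` {..<p}))"
    and p: "card S = p + 2" and l: "6 \<le> l" "l < p"
    and z: "path_tournament z p" and vw: "v \<notin> z ` {..<p}" "w \<notin> z ` {..<p}" "v \<noteq> w"
    and w: "\<not> leaps z p w" "i < p" "E (z i) w" "j < p" "E w (z j)"
    and maxp: "\<And>z'. path_tournament z' (Suc p) \<Longrightarrow> \<not> z' ` {..<Suc p} \<subseteq> S"
  shows "card S - l + 4 \<le> card (strong_sets l S) \<or>
    twin_ended S \<and> card S - l + 3 \<le> card (strong_sets l S)"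
proof -
  let ?a = "\<lambda>u. card (attached l z p u)"
  have cnt: "p - l + 1 + ?a v + ?a w + card (both l S v w) \<le> card (strong_sets l S)"
    by (rule two_extra_vertices_count[OF z vw S(2)]) (use l in auto)
  then have many: ?thesis if "5 \<le> ?a v + ?a w + card (both l S v w)" using that l p by linarith
  have no_ext: "\<not> extends_start z p u" "\<not> extends_end z p u" if "u \<in> {v, w}" for u
  proof -
    have u: "u \<notin> z ` {..<p}" "insert u (z ` {..<p}) \<subseteq> S" using that vw S(2) by auto
    show "\<not> extends_start z p u"
      using path_cons[OF z u(1)] maxp u(2) by metis
    show "\<not> extends_end z p u"
      using path_snoc[OF z u(1)] maxp u(2) by metis
  qed
  have w2: "3 \<le> ?a w \<or> 2 \<le> ?a w \<and> (near_start z p w \<or> near_end z p w)"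
    using no_leap_cases[OF z vw(2) w(1) l w(2-5)] no_ext[of w] by blast
  consider "(\<forall>k<p. E (z k) v) \<or> (\<forall>k<p. E v (z k))" | "leaps z p v" |
    i' j' where "\<not> leaps z p v" "i' < p" "E (z i') v" "j' < p" "E v (z j')"
    using off_path_nbr[OF vw(1)] by blast
  then show ?thesis
  proof cases
    case 1
    have "3 \<le> card (both l S v w)" by (rule constant_extra_vertex[OF z vw S l 1 w maxp])
    then show ?thesis using w2 by (intro many) linarith
  next
    case 2
    then have "4 \<le> ?a v" using leaps_attached[OF z vw(1) _ l] by blast
    then show ?thesis using w2 by (intro many) linarith
  next
    case 3
    have v2: "3 \<le> ?a v \<or> 2 \<le> ?a v \<and> (near_start z p v \<or> near_end z p v)"
      using no_leap_cases[OF z vw(1) 3(1) l 3(2-5)] no_ext[of v] by blast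
    have one: ?thesis if "1 \<le> card (both l S v w)" using that v2 w2 by (intro many) linarith
    have joint: "1 \<le> card (both l S v w)"
      if "X \<subseteq> {..<p}" "card X + 2 = l" "strong (insert v (insert w (z ` X)))" for X
      using both_nonempty[OF both_member[OF z vw that, of S] fin] S(2) by simp
    have opposite: ?thesis
      if uu: "{u, u'} = {v, w}" and s: "near_start z p u" and e: "near_end z p u'" for u u'
    proof -
      have ne: "u \<noteq> u'" using uu vw(3) by auto
      have off: "u \<notin> z ` {..<p}" "u' \<notin> z ` {..<p}" using uu vw by (auto simp: doubleton_eq_iff)
      have ins: "insert v (insert w X) = insert u (insert u' X)" for X using uu by auto
      show ?thesis
      proof (cases "E u u'")
        case True
        have "strong (insert u (insert u' (z ` {0..<l - 2})))"
          by (rule strong_ear[OF strong_interval[OF z], of _ _ "z 2" "z 0"])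
            (use True s e l in \<open>auto simp: near_start_def near_end_def\<close>)
        then have "1 \<le> card (both l S v w)" by (intro joint[of "{0..<l - 2}"]) (use l ins in auto)
        then show ?thesis by (rule one)
      next
        case False
        then have "E u' u" using total ne by blast
        then have "twin_ended S" unfolding twin_ended_def
          using z off ne s e p S(2) ins[of "z ` {..<p}"] by auto
        then show ?thesis using cnt v2 w2 l p by linarith
      qed
    qed
    consider "3 \<le> ?a v" | "3 \<le> ?a w" | "near_start z p v" "near_start z p w" |
      "near_end z p v" "near_end z p w" | "near_start z p v" "near_end z p w" |
      "near_end z p v" "near_start z p w"
      using v2 w2 by blast
    then show ?thesis
    proof cases
      case 3
      have A: "strong (z ` {1..<l - 1})" by (rule strong_interval[OF z]) (use l in auto)
      have "strong (insert w (z ` {1..<l - 1}))"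
        by (rule strong_insert[OF A, of "z 2" "z 1"]) (use 3 l in \<open>auto simp: near_start_def\<close>)
      then have "strong (insert v (insert w (z ` {1..<l - 1})))"
        by (rule strong_insert[of _ "z 2" "z 1"]) (use 3 l in \<open>auto simp: near_start_def\<close>)
      then show ?thesis by (intro one joint[of "{1..<l - 1}"]) (use l in auto)
    next
      case 4
      let ?I = "{p + 1 - l..<p - 1}"
      have A: "strong (z ` ?I)" by (rule strong_interval[OF z]) (use l in auto)
      have m: "z (p - 2) \<in> z ` ?I" "z (p - 3) \<in> z ` ?I" by (rule imageI, use l in force)+
      have e: "E (z (p - 2)) u" "E u (z (p - 3))" if "u \<in> {v, w}" for u
        using 4 l that unfolding near_end_def by auto
      have "strong (insert w (z ` ?I))" using strong_insert[OF A m] e[of w] by blast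
      then have "strong (insert v (insert w (z ` ?I)))"
        using strong_insert[of _ "z (p - 2)" "z (p - 3)" v] m e[of v] by blast
      then show ?thesis by (intro one joint[of ?I]) (use l in auto)
    next
      case 5
      then show ?thesis by (intro opposite[of v w]) auto
    next
      case 6
      then show ?thesis by (intro opposite[of w v]) auto
    qed (use v2 w2 many in linarith)+
  qed
qed

text \<open>
  A vertex added to \<open>twin_ended\<close> lies in at least two strong \<open>l\<close>-subsets, so the excess over the
  bound grows with it. If its arcs to the path do not give two such sets already, it prolongs the path or is
  constant on it, and one of the two duplicated end vertices helps.
\<close>

lemma twin_ended_extra_vertex:
  assumes fin: "finite S" and S: "twin_ended S" and x: "x \<notin> S" "a \<in> S" "E a x" "b \<in> S" "E x b"
    and l: "6 \<le> l" "l + 3 \<le> card S"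
  shows "2 \<le> card (through l (insert x S) x)"
proof -
  define p where "p = card S - 2"
  obtain z v w where z: "path_tournament z p" and vw: "v \<notin> z ` {..<p}" "w \<notin> z ` {..<p}" "v \<noteq> w"
    and v: "near_start z p v" and w: "near_end z p w" and wv: "E w v"
    and S': "S = insert v (insert w (z ` {..<p}))"
    using S unfolding twin_ended_def p_def by blast
  have lp: "l < p" using l unfolding p_def by simp
  have xP: "x \<notin> z ` {..<p}" "x \<noteq> v" "x \<noteq> w" using x(1) S' by auto
  note off = off_path_nbr[OF xP(1)]
  have two: ?thesis if "U \<in> through l (insert x S) x" "U' \<in> through l (insert x S) x" "U \<noteq> U'" for U U'
  proof -
    have "card {U, U'} \<le> card (through l (insert x S) x)"
      by (rule card_mono) (use that finite_through fin in auto)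
    then show ?thesis using that(3) by simp
  qed
  have att: ?thesis if "2 \<le> card (attached l z p x)"
    using card_attached_le[OF z xP(1), of "insert x S" l] that S' fin by fastforce
  have mem1: "insert x (z ` X) \<in> through l (insert x S) x"
    if "X \<subseteq> {..<p}" "card X + 1 = l" "strong (insert x (z ` X))" for X
  proof -
    have "finite X" "x \<notin> z ` X" using that(1) finite_subset xP by auto
    then show ?thesis
      using that card_path[OF z that(1)] S' unfolding through_def strong_sets_def by auto
  qed
  have mem2: "insert x (insert y (z ` X)) \<in> through l (insert x S) x"
    if "y \<in> {v, w}" "X \<subseteq> {..<p}" "card X + 2 = l" "strong (insert x (insert y (z ` X)))" for X y
  proof -
    have fX: "finite X" using that(2) finite_subset by blast
    have "x \<notin> insert y (z ` X)" "y \<notin> z ` X" using that(1,2) xP vw by auto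
    then have "card (insert x (insert y (z ` X))) = l" using that(3) card_path[OF z that(2)] fX by simp
    moreover have "insert x (insert y (z ` X)) \<subseteq> insert x S" using that(1,2) S' by auto
    ultimately show ?thesis using that(4) unfolding through_def strong_sets_def by simp
  qed
  have shift: ?thesis
    if y: "y \<in> {v, w}" and s: "s + 1 + (l - 2) \<le> p"
      and st: "strong (insert x (insert y (z ` {s..<s + (l - 2)})))"
        "strong (insert x (insert y (z ` {s + 1..<s + 1 + (l - 2)})))" for y s
  proof (rule two)
    let ?U = "\<lambda>s. insert x (insert y (z ` {s..<s + (l - 2)}))"
    show "?U s \<in> through l (insert x S) x" by (rule mem2) (use y s st l in auto)
    show "?U (s + 1) \<in> through l (insert x S) x" by (rule mem2) (use y s st l in auto)
    have "z s \<in> ?U s" using l by auto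
    moreover have "z s \<notin> ?U (s + 1)" using path_vertex_eq[OF z] vw xP y s l by auto
    ultimately show "?U s \<noteq> ?U (s + 1)" by metis
  qed
  have int: "strong (z ` {s..<s + (l - 2)})" if "s + (l - 2) \<le> p" for s
    by (rule strong_interval[OF z]) (use that l in auto)
  consider "\<forall>k<p. E (z k) x" | "\<forall>k<p. E x (z k)" |
    i j where "i < p" "E (z i) x" "j < p" "E x (z j)"
    using off by blast
  then show ?thesis
  proof cases
    case 1
    then have "b = v \<or> b = w" using x S' asym by blast
    then show ?thesis
    proof
      assume "b = v"
      show ?thesis
      proof (rule shift[of v 0])
        show "strong (insert x (insert v (z ` {0..<0 + (l - 2)})))"
          by (rule strong_ear[OF int, of _ "z 1" "z 1"])
            (use 1 x \<open>b = v\<close> v l lp in \<open>auto simp: near_start_def\<close>)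
        show "strong (insert x (insert v (z ` {0 + 1..<0 + 1 + (l - 2)})))"
          by (rule strong_ear[OF int, of _ "z 1" "z 1"])
            (use 1 x \<open>b = v\<close> v l lp in \<open>auto simp: near_start_def\<close>)
      qed (use lp l in auto)
    next
      assume "b = w"
      show ?thesis
      proof (rule shift[of w 0])
        show "strong (insert x (insert w (z ` {0..<0 + (l - 2)})))"
          by (rule strong_ear[OF int, of _ "z 1" "z 1"])
            (use 1 x \<open>b = w\<close> w l lp in \<open>auto simp: near_end_def\<close>)
        show "strong (insert x (insert w (z ` {0 + 1..<0 + 1 + (l - 2)})))"
          by (rule strong_ear[OF int, of _ "z 1" "z 1"])
            (use 1 x \<open>b = w\<close> w l lp in \<open>auto simp: near_end_def\<close>)
      qed (use lp l in auto)
    qed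
  next
    case 2
    then have "a = v \<or> a = w" using x S' asym by blast
    then show ?thesis
    proof
      assume a: "a = v"
      have st: "strong (insert v (insert x (z ` {s..<s + (l - 2)})))" if "s \<le> 1" for s
        by (rule strong_ear[OF int, of _ "z 2" "z 2"])
          (use 2 x a v l lp that in \<open>auto simp: near_start_def\<close>)
      show ?thesis
        by (rule shift[of v 0]) (use st[of 0] st[of 1] l lp in \<open>auto simp: insert_commute\<close>)
    next
      assume a: "a = w"
      have st: "strong (insert w (insert x (z ` {s..<s + (l - 2)})))" if s: "p + 1 - l \<le> s" "s + (l - 2) \<le> p" for s
      proof -
        have m: "z (p - 2) \<in> z ` {s..<s + (l - 2)}" by (rule imageI) (use s l lp in auto)
        have "E (z (p - 2)) w" "E w x" "E x (z (p - 2))"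
          using 2 x a w l lp unfolding near_end_def by auto
        then show ?thesis using strong_ear[OF int[OF s(2)] m m] by blast
      qed
      show ?thesis
        by (rule shift[of w "p + 1 - l"])
          (use st[of "p + 1 - l"] st[of "p + 1 - l + 1"] l lp in \<open>auto simp: insert_commute\<close>)
    qed
  next
    case 3
    show ?thesis
    proof (cases "leaps z p x")
      case True
      then show ?thesis using att leaps_attached[OF z xP(1) True l(1) lp] by linarith
    next
      case False
      consider "extends_start z p x" | "extends_end z p x" | "2 \<le> card (attached l z p x)"
        using no_leap_cases[OF z xP(1) False l(1) lp 3] by fastforce
      then show ?thesis
      proof cases
        case 1
        note e = 1[unfolded extends_start_def]
        have x1: "strong (insert x (z ` {0..<l - 1}))"
          by (rule strong_insert[OF strong_interval[OF z], of _ _ "z 1" "z 0"]) (use e l lp in auto)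
        have "strong (insert x (z ` {0..<l - 2}))"
          by (rule strong_insert[OF strong_interval[OF z], of _ _ "z 1" "z 0"]) (use e l lp in auto)
        then have "strong (insert v (insert x (z ` {0..<l - 2})))"
          by (rule strong_insert[of _ "z 2" "z 1"]) (use v l lp in \<open>auto simp: near_start_def\<close>)
        then have x2: "strong (insert x (insert v (z ` {0..<l - 2})))" by (simp add: insert_commute)
        show ?thesis
        proof (rule two)
          show "insert x (z ` {0..<l - 1}) \<in> through l (insert x S) x"
            by (rule mem1[OF _ _ x1]) (use l lp in auto)
          show "insert x (insert v (z ` {0..<l - 2})) \<in> through l (insert x S) x"
            by (rule mem2[OF _ _ _ x2]) (use l lp in auto)
          have "v \<notin> insert x (z ` {0..<l - 1})" using xP vw lp by auto
          then show "insert x (z ` {0..<l - 1}) \<noteq> insert x (insert v (z ` {0..<l - 2}))" by blast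
        qed
      next
        case 2
        note e = 2[unfolded extends_end_def]
        have x1: "strong (insert x (z ` {p + 1 - l..<p}))"
          by (rule strong_insert[OF strong_interval[OF z], of _ _ "z (p - 1)" "z (p - 2)"])
            (use e l lp in auto)
        have "strong (insert x (z ` {p + 2 - l..<p}))"
          by (rule strong_insert[OF strong_interval[OF z], of _ _ "z (p - 1)" "z (p - 2)"])
            (use e l lp in auto)
        then have "strong (insert w (insert x (z ` {p + 2 - l..<p})))"
          by (rule strong_insert[of _ "z (p - 2)" "z (p - 3)"]) (use w l lp in \<open>auto simp: near_end_def\<close>)
        then have x2: "strong (insert x (insert w (z ` {p + 2 - l..<p})))" by (simp add: insert_commute)
        show ?thesis
        proof (rule two)
          show "insert x (z ` {p + 1 - l..<p}) \<in> through l (insert x S) x"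
            by (rule mem1[OF _ _ x1]) (use l lp in auto)
          show "insert x (insert w (z ` {p + 2 - l..<p})) \<in> through l (insert x S) x"
            by (rule mem2[OF _ _ _ x2]) (use l lp in auto)
          have "w \<notin> insert x (z ` {p + 1 - l..<p})" using xP vw lp by auto
          then show "insert x (z ` {p + 1 - l..<p}) \<noteq> insert x (insert w (z ` {p + 2 - l..<p}))" by blast
        qed
      qed (rule att)
    qed
  qed
qed

section \<open>The minimal number of strong sets\<close>

text \<open>
  Double counting: a strong set that omits two vertices is found at most twice by deleting first a
  vertex of \<open>R\<close> and then another vertex.
\<close>

lemma pair_count:
  assumes fin: "finite S" and R: "R \<subseteq> S" and k: "\<And>v. v \<in> R \<Longrightarrow> k \<le> card (strong_sets l (S - {v}))"
    and l: "card S = l + 2"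
  shows "card R * k \<le> 2 * card (strong_sets l S)"
proof -
  have finR: "finite R" using fin R finite_subset by blast
  have "card R * k \<le> (\<Sum>v\<in>R. card (strong_sets l (S - {v})))"
    using sum_mono[of R "\<lambda>_. k"] k by simp
  also have "\<dots> = card (SIGMA v:R. strong_sets l (S - {v}))"
    using finR fin finite_strong_sets by (subst card_SigmaI) auto
  also have "\<dots> \<le> card (SIGMA U:strong_sets l S. S - U)"
  proof (rule card_inj_on_le)
    show "inj_on prod.swap (SIGMA v:R. strong_sets l (S - {v}))" by simp
    show "prod.swap ` (SIGMA v:R. strong_sets l (S - {v})) \<subseteq> (SIGMA U:strong_sets l S. S - U)"
      using R unfolding strong_sets_def by auto
    show "finite (SIGMA U:strong_sets l S. S - U)" using finite_strong_sets[OF fin] fin by auto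
  qed
  also have "\<dots> = (\<Sum>U\<in>strong_sets l S. card (S - U))"
    using finite_strong_sets[OF fin] fin by (subst card_SigmaI) auto
  also have "\<dots> = (\<Sum>U\<in>strong_sets l S. 2)"
    using l fin by (intro sum.cong refl)
      (auto simp: strong_sets_def card_Diff_subset finite_subset)
  finally show ?thesis by simp
qed

lemma strong_sets_removable:
  assumes "finite S" "card S = Suc l"
  shows "card (strong_sets l S) = card (removable S)"
proof -
  have "bij_betw (\<lambda>v. S - {v}) (removable S) (strong_sets l S)"
    unfolding bij_betw_def
  proof
    show "inj_on (\<lambda>v. S - {v}) (removable S)" by (rule inj_onI) (auto simp: removable_def)
    show "(\<lambda>v. S - {v}) ` removable S = strong_sets l S"
    proof
      show "(\<lambda>v. S - {v}) ` removable S \<subseteq> strong_sets l S"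
        unfolding removable_def strong_sets_def using assms by auto
      show "strong_sets l S \<subseteq> (\<lambda>v. S - {v}) ` removable S"
      proof
        fix U assume U: "U \<in> strong_sets l S"
        then have "card (S - U) = 1"
          using assms unfolding strong_sets_def by (auto simp: card_Diff_subset finite_subset)
        then obtain v where v: "S - U = {v}" using card_1_singletonE by blast
        then have "U = S - {v}" using U unfolding strong_sets_def by auto
        then show "U \<in> (\<lambda>v. S - {v}) ` removable S"
          using U v unfolding removable_def strong_sets_def by blast
      qed
    qed
  qed
  then show ?thesis using bij_betw_same_card by metis
qed

text \<open>
  The induction starts at \<open>n = l + 2\<close>, where the inequality is always strict. This makes
  \<open>twin_ended\<close> the only case of equality for all larger \<open>n\<close>.
\<close>

theorem many_strong_sets:
  assumes "finite S" "strong S" "diameter_le S (card S - 3)" "6 \<le> l" "l + 2 \<le> card S"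
  shows "card S - l + 4 \<le> card (strong_sets l S) \<or>
    l + 3 \<le> card S \<and> twin_ended S \<and> card S - l + 3 \<le> card (strong_sets l S)"
  using assms
proof (induction "card S" arbitrary: S rule: less_induct)
  case less
  note S = less.prems(1-3) and l = less.prems(4,5)
  show ?case
  proof (cases "\<exists>z. path_tournament z (card S - 1) \<and> z ` {..<card S - 1} \<subseteq> S")
    case True
    then show ?thesis using long_path_many_strong_sets[OF S l] by blast
  next
    case False
    then have maxp: "\<not> z ` {..<card S - 1} \<subseteq> S" if "path_tournament z (card S - 1)" for z
      using that by blast
    have del: "finite (S - {v})" "card (S - {v}) = card S - 1" if "v \<in> S" for v
      using S(1) that by auto
    show ?thesis
    proof (cases "card S = l + 2")
      case True
      \<comment> \<open>with at most two removable vertices left after a deletion, the rest would be a long path\<close>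
      have r4: "4 \<le> card (removable S)" using four_removable[OF S(2,1) _ S(3)] l by simp
      have "3 \<le> card (strong_sets l (S - {v}))" if v: "v \<in> removable S" for v
      proof (rule ccontr)
        have vS: "v \<in> S" "strong (S - {v})" using v unfolding removable_def by auto
        assume "\<not> ?thesis"
        then have r2: "card (removable (S - {v})) \<le> 2"
          using strong_sets_removable[OF del(1)[OF vS(1)], of l] del(2)[OF vS(1)] True by simp
        obtain z where "path_tournament z (card (S - {v}))" "z ` {..<card (S - {v})} = S - {v}"
          by (rule removable_le_2_imp_path[OF vS(2) del(1)[OF vS(1)] _ r2])
            (use del(2)[OF vS(1)] l in auto)
        then show False using maxp[of z] del(2)[OF vS(1)] by auto
      qed
      then have "card (removable S) * 3 \<le> 2 * card (strong_sets l S)"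
        by (intro pair_count[OF S(1) _ _ True]) (auto simp: removable_def)
      then show ?thesis using r4 True by simp
    next
      case False
      then have n: "l + 3 \<le> card S" using l by simp
      have "2 \<le> card (removable S)" by (rule two_removable[OF S(2,1)]) (use n l in simp)
      then have "removable S \<noteq> {}" by auto
      then obtain v where v: "v \<in> S" "strong (S - {v})" unfolding removable_def by auto
      have ins: "insert v (S - {v}) = S" using v by auto
      have rem: "card (strong_sets l S) = card (strong_sets l (S - {v})) + card (through l S v)"
        by (rule card_strong_sets_remove[OF S(1)])
      have one: "1 \<le> card (through l S v)"
        by (rule through_nonempty[OF S(1,2) v(1)]) (use l in auto)
      have "S \<noteq> {v}" using l by auto
      then have nbrs: "\<exists>a\<in>S - {v}. E v a" "\<exists>b\<in>S - {v}. E b v"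
        using strong_nbrs[OF S(2) v(1)] by blast+
      show ?thesis
      proof (cases "diameter_le (S - {v}) (card (S - {v}) - 3)")
        case True
        have "card (S - {v}) < card S" using del[OF v(1)] n by simp
        from less.hyps[OF this del(1)[OF v(1)] v(2) True l(1)]
        have "card (S - {v}) - l + 4 \<le> card (strong_sets l (S - {v})) \<or>
          l + 3 \<le> card (S - {v}) \<and> twin_ended (S - {v}) \<and>
          card (S - {v}) - l + 3 \<le> card (strong_sets l (S - {v}))"
          using del[OF v(1)] n by simp
        then show ?thesis
        proof
          assume "card (S - {v}) - l + 4 \<le> card (strong_sets l (S - {v}))"
          then show ?thesis using rem one del[OF v(1)] n by linarith
        next
          assume h: "l + 3 \<le> card (S - {v}) \<and> twin_ended (S - {v}) \<and>
            card (S - {v}) - l + 3 \<le> card (strong_sets l (S - {v}))"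
          obtain a b where "a \<in> S - {v}" "E v a" "b \<in> S - {v}" "E b v" using nbrs by blast
          then have "2 \<le> card (through l S v)"
            using twin_ended_extra_vertex[OF del(1)[OF v(1)], of v b a l] h l(1) unfolding ins by blast
          then show ?thesis using h rem del[OF v(1)] n by linarith
        qed
      next
        case False
        then obtain x y where xy: "x \<in> S - {v}" "y \<in> S - {v}" "y \<notin> reach (S - {v}) x (card S - 4)"
          unfolding diameter_le_def using del(2)[OF v(1)] by auto
        define p where "p = card S - 2"
        have p: "card S - 4 + 2 = p" "card S = p + 2" "card S - 1 = Suc p" "l < p"
          unfolding p_def using n l by auto
        obtain z where z: "path_tournament z p" "z ` {..<p} \<subseteq> S - {v}"
          and nl: "\<And>w i j. w \<in> S - {v} \<Longrightarrow> i < p \<Longrightarrow> j < p \<Longrightarrow> E (z i) w \<Longrightarrow> E w (z j) \<Longrightarrow> j \<le> i + 2"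
          by (rule geodesic[OF v(2) xy, unfolded p(1)]) blast
        have "card (S - {v} - z ` {..<p}) = 1"
          using z card_path[OF z(1), of "{..<p}"] del[OF v(1)] p by (subst card_Diff_subset) auto
        then obtain w where w: "S - {v} - z ` {..<p} = {w}" using card_1_singletonE by blast
        have S': "S = insert v (insert w (z ` {..<p}))" using w z v by auto
        have vw: "v \<notin> z ` {..<p}" "w \<notin> z ` {..<p}" "v \<noteq> w" using w z by auto
        have wv: "w \<in> S - {v}" using w by blast
        have Sw: "S - {v} - {w} = z ` {..<p}" using S' vw by auto
        have "S - {v} \<noteq> {w}"
        proof
          assume "S - {v} = {w}"
          then have "card (S - {v}) = 1" by simp
          then show False using del(2)[OF v(1)] l by simp
        qed
        then have "\<exists>a\<in>z ` {..<p}. E w a" "\<exists>b\<in>z ` {..<p}. E b w"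
          using strong_nbrs[OF v(2) wv] unfolding Sw by simp_all
        then obtain i j where ij: "i < p" "E (z i) w" "j < p" "E w (z j)" by auto
        have nlw: "\<not> leaps z p w"
        proof
          assume "leaps z p w"
          then obtain i j where h: "i + 3 \<le> j" "j < p" "E (z i) w" "E w (z j)"
            unfolding leaps_def by blast
          then have "j \<le> i + 2" using nl[OF wv _ h(2-4)] by simp
          then show False using h(1) by simp
        qed
        have "card S - l + 4 \<le> card (strong_sets l S) \<or>
          twin_ended S \<and> card S - l + 3 \<le> card (strong_sets l S)"
          by (rule two_extra_vertices[OF S(1,2) S' p(2) l(1) p(4) z(1) vw nlw ij])
            (use maxp p(3) in simp)
        then show ?thesis using n by blast
      qed
    qed
  qed
qed

end

section \<open>Hamiltonian circuits of strong sets\<close>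

definition circuit :: "('a \<Rightarrow> 'a \<Rightarrow> bool) \<Rightarrow> 'a list \<Rightarrow> bool" where
  "circuit E xs \<longleftrightarrow> xs \<noteq> [] \<and> distinct xs \<and> successively E (xs @ [hd xs])"

lemma circuit_iff:
  "circuit E xs \<longleftrightarrow> xs \<noteq> [] \<and> distinct xs \<and> successively E xs \<and> E (last xs) (hd xs)"
  unfolding circuit_def by (cases "xs = []") (simp_all add: successively_append_iff)

lemma circuit_rotate:
  assumes "circuit E (xs @ ys)"
  shows "circuit E (ys @ xs)"
proof (cases "xs = [] \<or> ys = []")
  case False
  then show ?thesis using assms unfolding circuit_iff by (auto simp: successively_append_iff)
qed (use assms in auto)

lemma circuit_snoc:
  "circuit E r \<Longrightarrow> v \<notin> set r \<Longrightarrow> E (last r) v \<Longrightarrow> E v (hd r) \<Longrightarrow> circuit E (r @ [v])"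
  unfolding circuit_iff by (simp add: successively_append_iff)

text \<open>
  Somewhere along the circuit a vertex with an arc to \<open>v\<close> is followed by one with an arc from \<open>v\<close>.
\<close>

lemma circuit_insert:
  assumes xs: "circuit E xs" and v: "v \<notin> set xs"
    and b: "b \<in> set xs" "E b v" and c: "c \<in> set xs" "\<not> E c v"
    and out: "\<And>x. x \<in> set xs \<Longrightarrow> \<not> E x v \<Longrightarrow> E v x"
  shows "\<exists>ys. circuit E ys \<and> set ys = insert v (set xs)"
proof -
  obtain as bs where split: "xs = as @ c # bs" using c by (meson split_list)
  have ys: "circuit E (c # bs @ as)" using circuit_rotate[of E as "c # bs"] xs split by simp
  have sy: "set (c # bs @ as) = set xs" using split by auto
  have "\<exists>x\<in>set (c # bs @ as). E x v" using b unfolding sy by blast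
  then obtain us x ws where uw: "c # bs @ as = us @ x # ws" "E x v" "\<forall>z\<in>set ws. \<not> E z v"
    using split_list_last_prop[of "c # bs @ as" "\<lambda>x. E x v"] by blast
  let ?r = "ws @ us @ [x]"
  have r: "circuit E ?r" using circuit_rotate[of E "us @ [x]" ws] ys uw(1) by simp
  have "us \<noteq> []" using uw c(2) by (cases us) auto
  then have "hd us = c" using uw(1) by (cases us) auto
  then have "\<not> E (hd ?r) v" using uw(3) c(2) \<open>us \<noteq> []\<close> by (cases ws) auto
  moreover have sr: "set ?r = set xs" using uw(1) sy by (metis Un_commute append.assoc append_Cons append_Nil set_append)
  ultimately have "E v (hd ?r)" using out[of "hd ?r"] by (metis hd_in_set append_is_Nil_conv not_Cons_self2)
  moreover have "E (last ?r) v" using uw(2) by simp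
  moreover have "v \<notin> set ?r" using v unfolding sr .
  ultimately have "circuit E (?r @ [v])" using circuit_snoc[OF r] by blast
  moreover have "set (?r @ [v]) = insert v (set xs)" unfolding set_append[of ?r] sr by simp
  ultimately show ?thesis by blast
qed

context tournament_relation begin

text \<open>
  Delete a removable vertex and insert it into the Hamiltonian circuit of the rest.
\<close>

theorem strong_hamiltonian:
  assumes "finite S" "strong S" "3 \<le> card S"
  shows "\<exists>xs. circuit E xs \<and> set xs = S"
  using assms
proof (induction "card S" arbitrary: S rule: less_induct)
  case less
  show ?case
  proof (cases "card S = 3")
    case True
    then obtain a b c where S: "S = {a, b, c}" "a \<noteq> b" "b \<noteq> c" "a \<noteq> c" by (auto simp: card_3_iff)
    have a: "E a b \<or> E a c" "E b a \<or> E c a"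
      and b: "E b a \<or> E b c" "E a b \<or> E c b"
      and c: "E c a \<or> E c b" "E a c \<or> E b c"
      using strong_nbrs[OF less.prems(2), of a] strong_nbrs[OF less.prems(2), of b]
        strong_nbrs[OF less.prems(2), of c] S by auto
    show ?thesis
    proof (cases "E a b")
      case True
      then have "E b c" "E c a" using a b c asym by blast+
      then have "circuit E [a, b, c]" using True S by (simp add: circuit_def)
      then show ?thesis using S by (intro exI[of _ "[a, b, c]"]) auto
    next
      case False
      then have "E a c" "E c b" "E b a" using a b c asym by blast+
      then have "circuit E [a, c, b]" using S by (simp add: circuit_def)
      then show ?thesis using S by (intro exI[of _ "[a, c, b]"]) auto
    qed
  next
    case False
    then have "2 \<le> card (removable S)" using two_removable[OF less.prems(2,1)] less.prems(3) by simp
    then have "removable S \<noteq> {}" by auto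
    then obtain v where v: "v \<in> S" "strong (S - {v})" unfolding removable_def by blast
    have card: "card (S - {v}) = card S - 1" using less.prems v by simp
    have "\<exists>xs. circuit E xs \<and> set xs = S - {v}"
      by (rule less.hyps) (use less.prems v False card in auto)
    then obtain xs where xs: "circuit E xs" "set xs = S - {v}" by blast
    have "S \<noteq> {v}" using less.prems(3) by auto
    then obtain b c where "b \<in> S - {v}" "E b v" "c \<in> S - {v}" "E v c"
      using strong_nbrs[OF less.prems(2) v(1)] by blast
    then have bc: "b \<in> set xs" "E b v" "c \<in> set xs" "\<not> E c v" "v \<notin> set xs"
      using xs(2) asym by auto
    have "E v x" if "x \<in> set xs" "\<not> E x v" for x
      using total[of x v] that xs(2) by auto
    then obtain ys where "circuit E ys" "set ys = insert v (set xs)"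
      using circuit_insert[OF xs(1) bc(5,1-4)] by blast
    then show ?thesis using xs(2) v by (intro exI[of _ ys]) auto
  qed
qed

text \<open>
  The two copies of an end of the path are interchangeable, so that they can be named according to the arc
  between them.
\<close>

lemma twin_ended_coordinates:
  assumes S: "twin_ended S" and n: "card S = n" "7 \<le> n"
  obtains z v w where "path_tournament z (n - 2)" "v \<notin> z ` {..<n - 2}" "w \<notin> z ` {..<n - 2}"
    "v \<noteq> w" "near_start z (n - 2) v" "near_end z (n - 2) w" "E w v"
    "S = insert v (insert w (z ` {..<n - 2}))" "E v (z 0)" "E (z (n - 3)) w"
proof -
  let ?p = "n - 2"
  let ?Q = "\<lambda>z v w. path_tournament z ?p \<and> v \<notin> z ` {..<?p} \<and> w \<notin> z ` {..<?p} \<and> v \<noteq> w \<and>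
    near_start z ?p v \<and> near_end z ?p w \<and> E w v \<and> S = insert v (insert w (z ` {..<?p}))"
  obtain z v w where Q: "?Q z v w" using S n unfolding twin_ended_def by blast
  have "\<exists>z v. ?Q z v w \<and> E v (z 0)"
  proof (cases "E v (z 0)")
    case False
    let ?z = "z(0 := v)"
    have z0: "E (z 0) v" using False off_path_nbr[of v z ?p 0] Q n by auto
    have "z x \<noteq> z 0" if "x < ?p" "x \<noteq> 0" for x using path_vertex_eq[of z ?p x 0] Q that by auto
    moreover have "z 0 \<noteq> v" using Q n by auto
    ultimately have off: "z 0 \<notin> ?z ` {..<?p}" by (auto split: if_splits) metis
    have offw: "w \<notin> ?z ` {..<?p}" using Q by (auto split: if_splits)
    have img: "insert (z 0) (?z ` {..<?p}) = insert v (z ` {..<?p})"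
    proof -
      have "{..<?p} = insert 0 {1..<?p}" using n by auto
      moreover have "?z ` insert 0 {1..<?p} = insert v (z ` {1..<?p})" by auto
      ultimately show ?thesis by auto
    qed
    have "path_tournament ?z ?p" using path_swap_start Q by blast
    moreover have "near_start ?z ?p (z 0)"
      unfolding near_start_def using path_tournamentD(2,3)[of z ?p] Q n by auto
    moreover have "near_end ?z ?p w" using Q n unfolding near_end_def by auto
    moreover have "E w (z 0)" using Q n unfolding near_end_def by auto
    moreover have "z 0 \<noteq> w" using Q n by auto
    moreover have "S = insert (z 0) (insert w (?z ` {..<?p}))" using Q img by auto
    ultimately have "?Q ?z (z 0) w \<and> E (z 0) (?z 0)" using off offw z0 by simp
    then show ?thesis by blast
  qed (use Q in blast)
  then obtain z v where Q: "?Q z v w" and v0: "E v (z 0)" by blast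
  show ?thesis
  proof (cases "E (z (n - 3)) w")
    case True
    then show ?thesis using that Q v0 by blast
  next
    case False
    let ?e = "z (n - 3)"
    let ?z = "z(n - 3 := w)"
    have n3: "?p = Suc (n - 3)" "n - 3 < ?p" using n by auto
    have e: "E w ?e" using False off_path_nbr[of w z ?p "n - 3"] Q n by auto
    have z: "path_tournament z (n - 3)" using Q n unfolding path_tournament_def inj_on_def by auto
    have "extends_end z (n - 3) w"
      unfolding extends_end_def using Q n unfolding near_end_def by (auto simp: numeral_3_eq_3)
    moreover have "w \<notin> z ` {..<n - 3}" using Q by auto
    ultimately have p1: "path_tournament ?z (Suc (n - 3))" "?z ` {..<Suc (n - 3)} = insert w (z ` {..<n - 3})"
      using path_snoc[OF z, of w] by blast+
    have old: "z ` {..<?p} = insert ?e (z ` {..<n - 3})" unfolding n3 lessThan_Suc by simp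
    have "z x \<noteq> ?e" if "x < n - 3" for x using path_vertex_eq[of z ?p x "n - 3"] Q that by auto
    then have eoff: "?e \<notin> z ` {..<n - 3}" by auto metis
    have "v \<notin> ?z ` {..<?p}" "?e \<notin> ?z ` {..<?p}"
      using Q p1(2) eoff old unfolding n3(1) by auto
    moreover have "v \<noteq> ?e" using Q old by auto
    moreover have "near_start ?z ?p v" using Q n unfolding near_start_def by auto
    moreover have "near_end ?z ?p ?e"
    proof -
      have s: "Suc (n - 4) = n - 3" "n - 2 - 2 = n - 4" "n - 4 \<noteq> n - 3" using n by auto
      have "E (z (n - 4)) ?e" using path_tournamentD(2)[of z ?p "n - 4"] Q n s by auto
      moreover have "E ?e (z k)" if "k + 2 < ?p" for k
        using path_tournamentD(3)[of z ?p k "n - 3"] Q that by auto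
      ultimately show ?thesis unfolding near_end_def s(2) using s(3) by auto
    qed
    moreover have "E ?e v" using Q n unfolding near_start_def by auto
    moreover have "S = insert v (insert ?e (?z ` {..<?p}))" using Q p1(2) old unfolding n3(1) by auto
    moreover have "E v (?z 0)" using v0 n by simp
    ultimately show ?thesis using that[of ?z v ?e] p1(1) e unfolding n3(1) by simp
  qed
qed

end

section \<open>Circuits, distances and connectivity in digraphs\<close>

lemma pcas_decompose:
  "pcas u p v \<Longrightarrow> p \<noteq> [] \<Longrightarrow>
    p = zip (map fst p) (tl (map fst p) @ [v]) \<and> pawalk_verts u p = map fst p @ [v] \<and> hd (map fst p) = u"
proof (induction p arbitrary: u)
  case (Cons e es)
  then have fe: "fst e = u" and es: "pcas (snd e) es v" by auto
  show ?case
  proof (cases "es = []")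
    case True
    then show ?thesis using fe es by (cases e) auto
  next
    case False
    from Cons.IH[OF es False] have IH: "es = zip (map fst es) (tl (map fst es) @ [v])"
      "pawalk_verts (snd e) es = map fst es @ [v]" "hd (map fst es) = snd e" by auto
    obtain x xs where m: "map fst es = x # xs" using False by (cases es) auto
    then have "x = snd e" using IH(3) by simp
    then have "e = (u, x)" using fe by (cases e) auto
    then show ?thesis using IH(1,2) m by simp
  qed
qed simp

lemma pcas_compose:
  "pcas x (zip (x # ys) (ys @ [w])) w \<and> pawalk_verts x (zip (x # ys) (ys @ [w])) = x # ys @ [w] \<and>
   (set (zip (x # ys) (ys @ [w])) \<subseteq> A \<longleftrightarrow> successively (\<lambda>a b. (a, b) \<in> A) (x # ys @ [w]))"
  by (induction ys arbitrary: x) auto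

lemma cycle_iff_circuit:
  assumes "pair_wf_digraph T"
  shows "pre_digraph.cycle (with_proj T) p \<longleftrightarrow>
    (\<exists>xs. circuit (\<lambda>a b. (a, b) \<in> parcs T) xs \<and> p = zip xs (rotate1 xs))"
proof
  interpret pair_wf_digraph T by fact
  assume "pre_digraph.cycle (with_proj T) p"
  then obtain u where p: "set p \<subseteq> parcs T" "pcas u p u" "distinct (tl (pawalk_verts u p))" "p \<noteq> []"
    unfolding cycle_def awalk_def by auto
  define xs where "xs = map fst p"
  have d: "p = zip xs (tl xs @ [u])" "pawalk_verts u p = xs @ [u]" "hd xs = u"
    using pcas_decompose[OF p(2,4)] unfolding xs_def by auto
  obtain y ys where xs: "xs = y # ys" using p(4) unfolding xs_def by (cases p) auto
  then have y: "y = u" using d(3) by simp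
  have "successively (\<lambda>a b. (a, b) \<in> parcs T) (xs @ [u])"
    using pcas_compose[of y ys u "parcs T"] d(1) p(1) xs by simp
  moreover have "distinct xs" using p(3) d(2) xs y by auto
  ultimately show "\<exists>xs. circuit (\<lambda>a b. (a, b) \<in> parcs T) xs \<and> p = zip xs (rotate1 xs)"
    using d(1) xs y by (intro exI[of _ xs]) (simp add: circuit_def)
next
  interpret pair_wf_digraph T by fact
  assume "\<exists>xs. circuit (\<lambda>a b. (a, b) \<in> parcs T) xs \<and> p = zip xs (rotate1 xs)"
  then obtain x ys where c: "circuit (\<lambda>a b. (a, b) \<in> parcs T) (x # ys)" "p = zip (x # ys) (ys @ [x])"
    by (metis circuit_def list.exhaust rotate1.simps(2))
  have p: "pcas x p x" "pawalk_verts x p = x # ys @ [x]" "set p \<subseteq> parcs T"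
    using pcas_compose[of x ys x "parcs T"] c unfolding circuit_def by auto
  have "p \<noteq> []" using c(2) by simp
  then have "x \<in> pverts T" using p(1,3) by (cases p) (auto dest: arc_fst_in_verts)
  then show "pre_digraph.cycle (with_proj T) p"
    unfolding cycle_def awalk_def using p \<open>p \<noteq> []\<close> c(1) by (intro exI[of _ x]) (auto simp: circuit_def)
qed

lemma circuit_verts:
  assumes "pair_wf_digraph T" "circuit (\<lambda>a b. (a, b) \<in> parcs T) xs"
  shows "set xs \<subseteq> pverts T"
proof -
  interpret pair_wf_digraph T by fact
  obtain x ys where xs: "xs = x # ys" using assms(2) unfolding circuit_def by (cases xs) auto
  have "set (zip xs (rotate1 xs)) \<subseteq> parcs T"
    using pcas_compose[of x ys x "parcs T"] assms(2) xs unfolding circuit_def by simp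
  then have "fst ` set (zip xs (rotate1 xs)) \<subseteq> pverts T"
    by (intro image_subsetI arc_fst_in_verts) (erule subsetD)
  moreover have "set xs = fst ` set (zip xs (rotate1 xs))"
    by (metis length_rotate1 list.set_map map_fst_zip)
  ultimately show ?thesis by simp
qed

lemma finite_cycles:
  assumes "pair_fin_digraph T"
  shows "finite {p. pre_digraph.cycle (with_proj T) p \<and> length p = l}"
proof -
  interpret pair_fin_digraph T by fact
  have "{p. pre_digraph.cycle (with_proj T) p \<and> length p = l} \<subseteq> {p. set p \<subseteq> parcs T \<and> length p = l}"
    unfolding cycle_def awalk_def by auto
  then show ?thesis using finite_lists_length_eq[OF pair_finite_arcs] finite_subset by blast
qed

text \<open>
  The set of vertices of a circuit is invariant under rotation.
\<close>

lemma num_circuits_ge: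
  assumes T: "pair_fin_digraph T" and fin: "finite \<U>"
    and U: "\<And>U. U \<in> \<U> \<Longrightarrow> \<exists>xs. circuit (\<lambda>a b. (a, b) \<in> parcs T) xs \<and> set xs = U \<and> length xs = l"
  shows "card \<U> \<le> num_circuits l (with_proj T)"
proof -
  interpret pair_fin_digraph T by fact
  let ?C = "{p. pre_digraph.cycle (with_proj T) p \<and> length p = l}"
    and ?R = "{(p, q). \<exists>k. q = rotate k p}"
  let ?f = "\<lambda>X. \<Union>p\<in>X. fst ` set p"
  have "finite (?C // ?R)"
    unfolding quotient_def using finite_cycles[OF T, of l] by auto
  moreover have "\<U> \<subseteq> ?f ` (?C // ?R)"
  proof
    fix U assume "U \<in> \<U>"
    then obtain xs where xs: "circuit (\<lambda>a b. (a, b) \<in> parcs T) xs" "set xs = U" "length xs = l"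
      using U by blast
    let ?p = "zip xs (rotate1 xs)"
    have "?p \<in> ?C" using cycle_iff_circuit[OF pair_wf_digraph_axioms] xs by auto
    then have "?R `` {?p} \<in> ?C // ?R" by (rule quotientI)
    moreover have "?f (?R `` {?p}) = fst ` set ?p"
    proof
      show "?f (?R `` {?p}) \<subseteq> fst ` set ?p" by auto
      have "?p \<in> ?R `` {?p}" by (auto intro: exI[of _ 0])
      then show "fst ` set ?p \<subseteq> ?f (?R `` {?p})" by blast
    qed
    moreover have "fst ` set ?p = U"
      using xs(2) by (metis length_rotate1 list.set_map map_fst_zip)
    ultimately have "U = ?f (?R `` {?p})" "?R `` {?p} \<in> ?C // ?R" by simp_all
    then show "U \<in> ?f ` (?C // ?R)" by (rule image_eqI)
  qed
  ultimately have "card \<U> \<le> card (?C // ?R)" by (rule surj_card_le)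
  then show ?thesis unfolding num_circuits_def .
qed

lemma rotate_zip: "length xs = length ys \<Longrightarrow> rotate k (zip xs ys) = zip (rotate k xs) (rotate k ys)"
proof (induction k)
  case (Suc k)
  have "rotate1 (zip us vs) = zip (rotate1 us) (rotate1 vs)" if "length us = length vs" for us :: "'a list" and vs :: "'b list"
    using that by (cases us; cases vs) auto
  then show ?case using Suc by simp
qed simp

lemma num_circuits_le:
  assumes T: "pair_fin_digraph T" and fin: "finite F"
    and F: "\<And>xs. circuit (\<lambda>a b. (a, b) \<in> parcs T) xs \<Longrightarrow> length xs = l \<Longrightarrow> \<exists>k. rotate k xs \<in> F"
  shows "num_circuits l (with_proj T) \<le> card F"
proof -
  interpret pair_fin_digraph T by fact
  let ?C = "{p. pre_digraph.cycle (with_proj T) p \<and> length p = l}"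
    and ?R = "{(p, q). \<exists>k. q = rotate k p}"
  have cls: "?R `` {rotate k p} = ?R `` {p}" for k p
  proof -
    \<comment> \<open>enough full turns are added to undo the rotation by \<open>k\<close>\<close>
    have "\<exists>m. rotate j p = rotate m (rotate k p)" for j
    proof (cases "p = []")
      case False
      let ?n = "length p"
      have n: "?n \<noteq> 0" using False by simp
      have "k \<le> j + k * ?n" using n by (cases ?n) auto
      then have "rotate (j + k * ?n - k) (rotate k p) = rotate (j + k * ?n) p"
        by (simp add: rotate_rotate)
      also have "\<dots> = rotate j p" by (metis mod_mult_self1 mult.commute rotate_conv_mod)
      finally show ?thesis by metis
    qed simp
    then show ?thesis by (auto simp: rotate_rotate)
  qed
  have "?C // ?R \<subseteq> (\<lambda>xs. ?R `` {zip xs (rotate1 xs)}) ` F"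
  proof
    fix X assume "X \<in> ?C // ?R"
    then obtain p where p: "p \<in> ?C" "X = ?R `` {p}" by (rule quotientE)
    then have "pre_digraph.cycle (with_proj T) p" and lp: "length p = l" by blast+
    then obtain xs where xs: "circuit (\<lambda>a b. (a, b) \<in> parcs T) xs" "p = zip xs (rotate1 xs)"
      using cycle_iff_circuit[OF pair_wf_digraph_axioms] by blast
    then have "length xs = l" using lp by simp
    then obtain k where k: "rotate k xs \<in> F" using F xs(1) by blast
    have "rotate k p = zip (rotate k xs) (rotate1 (rotate k xs))"
      unfolding xs(2) by (simp add: rotate_zip rotate1_rotate_swap)
    then have "X = ?R `` {zip (rotate k xs) (rotate1 (rotate k xs))}" using cls[of k p] p(2) by simp
    then show "X \<in> (\<lambda>xs. ?R `` {zip xs (rotate1 xs)}) ` F" using k by blast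
  qed
  then have "card (?C // ?R) \<le> card ((\<lambda>xs. ?R `` {zip xs (rotate1 xs)}) ` F)"
    by (rule card_mono[rotated]) (use fin in simp)
  also have "\<dots> \<le> card F" using fin by (rule card_image_le)
  finally show ?thesis unfolding num_circuits_def .
qed

text \<open>
  Pairs with a vertex outside of the tournament are oriented by a linear order of the type.
\<close>

lemma extend_to_tournament_relation:
  fixes T :: "'a pair_pre_digraph"
  assumes "tournament T"
  obtains E :: "'a \<Rightarrow> 'a \<Rightarrow> bool" where "tournament_relation E"
    "\<And>x y. x \<in> pverts T \<Longrightarrow> y \<in> pverts T \<Longrightarrow> E x y \<longleftrightarrow> (x, y) \<in> parcs T"
proof -
  interpret tournament T by fact
  obtain r :: "'a rel" where "well_order_on UNIV r" using well_order_on by blast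
  then have r: "total_on UNIV r" "antisym r"
    unfolding well_order_on_def linear_order_on_def partial_order_on_def by auto
  define E where "E x y \<longleftrightarrow> (if x \<in> pverts T \<and> y \<in> pverts T then (x, y) \<in> parcs T else x \<noteq> y \<and> (x, y) \<in> r)"
    for x y
  have "tournament_relation E"
  proof
    show "\<not> E x x" for x unfolding E_def using pair_no_loops[of "(x, x)"] by auto
    show "E x y \<or> E y x" if "x \<noteq> y" for x y
      using that orientation[of x y] r(1) unfolding E_def total_on_def by auto
    show "\<not> E y x" if "E x y" for x y
    proof -
      have "x \<noteq> y" using that pair_no_loops[of "(x, x)"] unfolding E_def by (auto split: if_splits)
      then show ?thesis
        using that orientation[of x y] antisymD[OF r(2), of x y] unfolding E_def by (auto split: if_splits)
    qed
  qed
  then show ?thesis using that[of E] unfolding E_def by simp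
qed

lemma successively_mono_set:
  "successively P xs \<Longrightarrow> (\<And>x y. x \<in> set xs \<Longrightarrow> y \<in> set xs \<Longrightarrow> P x y \<Longrightarrow> Q x y) \<Longrightarrow> successively Q xs"
  by (induction xs rule: induct_list012) auto

lemma circuit_cong:
  assumes "circuit E xs" "\<And>x y. x \<in> set xs \<Longrightarrow> y \<in> set xs \<Longrightarrow> E x y \<Longrightarrow> E' x y"
  shows "circuit E' xs"
proof -
  have "set (xs @ [hd xs]) = set xs" using assms(1) unfolding circuit_def by auto
  then show ?thesis using assms successively_mono_set[of E "xs @ [hd xs]" E'] unfolding circuit_def by auto
qed

context tournament_relation begin

lemma reach_Cons: "E x a \<Longrightarrow> a \<in> S \<Longrightarrow> reach S a k \<subseteq> reach S x (Suc k)"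
proof (induction k)
  case (Suc k)
  then have "reach S a k \<subseteq> reach S x (Suc k)" by simp
  then show ?case by auto
qed auto

end

lemma strongly_connected_strong:
  assumes "tournament_relation E" and T: "pair_wf_digraph T"
    and E: "\<And>x y. x \<in> pverts T \<Longrightarrow> y \<in> pverts T \<Longrightarrow> E x y \<longleftrightarrow> (x, y) \<in> parcs T"
    and sc: "strongly_connected (with_proj T)"
  shows "tournament_relation.strong E (pverts T)"
proof -
  interpret pair_wf_digraph T by fact
  interpret tr: tournament_relation E by fact
  show ?thesis
    unfolding tr.strong_def
  proof (intro allI impI)
    fix B assume B: "B \<subseteq> pverts T" "B \<noteq> {}" "B \<noteq> pverts T"
    then obtain b a where ba: "b \<in> B" "a \<in> pverts T" "a \<notin> B" by blast
    then have "reachable (with_proj T) b a" using sc B(1) unfolding strongly_connected_def by auto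
    then have path: "(b, a) \<in> (parcs T)\<^sup>*" using reachable_rtranclI by fastforce
    show "\<exists>b\<in>B. \<exists>a\<in>pverts T - B. E b a"
    proof (rule ccontr)
      assume no: "\<not> ?thesis"
      from path have "a \<in> B"
      proof (induction rule: rtrancl_induct)
        case (step y z)
        then show ?case using no E B(1) in_arcsD2[OF step(2)] by blast
      qed (use ba in simp)
      then show False using ba by simp
    qed
  qed
qed

lemma diameter_reach:
  assumes "tournament_relation E" and T: "pair_wf_digraph T"
    and E: "\<And>x y. x \<in> pverts T \<Longrightarrow> y \<in> pverts T \<Longrightarrow> E x y \<longleftrightarrow> (x, y) \<in> parcs T"
    and d: "digraph_diameter (with_proj T) \<le> enat d"
  shows "tournament_relation.diameter_le E (pverts T) d"
proof -
  interpret pair_wf_digraph T by fact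
  interpret tr: tournament_relation E by fact
  have walk: "pcas x p y \<Longrightarrow> set p \<subseteq> parcs T \<Longrightarrow> y \<in> tr.reach (pverts T) x (length p)" for x y p
  proof (induction p arbitrary: x)
    case (Cons e p)
    then have e: "e = (x, snd e)" "(x, snd e) \<in> parcs T" by (cases e; auto)+
    then have "E x (snd e)" using E in_arcsD1[OF e(2)] in_arcsD2[OF e(2)] by blast
    then have "tr.reach (pverts T) (snd e) (length p) \<subseteq> tr.reach (pverts T) x (Suc (length p))"
      using tr.reach_Cons in_arcsD2[OF e(2)] by blast
    then show ?case using Cons by auto
  qed simp
  have "y \<in> tr.reach (pverts T) x d" if xy: "x \<in> pverts T" "y \<in> pverts T" for x y
  proof (cases "x = y")
    case True
    then show ?thesis using tr.reach_mono[of 0 d] by auto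
  next
    case False
    have "digraph_dist (with_proj T) x y \<le> digraph_diameter (with_proj T)"
      unfolding digraph_diameter_def
      by (rule SUP_upper2[of "(x, y)"]) (use xy False in auto)
    then have dd: "digraph_dist (with_proj T) x y \<le> enat d" using d by (rule order_trans)
    have "\<exists>p. pre_digraph.apath (with_proj T) x p y \<and> length p \<le> d"
    proof (rule ccontr)
      assume "\<not> ?thesis"
      then have "enat (Suc d) \<le> digraph_dist (with_proj T) x y"
        unfolding digraph_dist_def by (intro INF_greatest) (auto simp: not_le Suc_le_eq)
      then have "enat (Suc d) \<le> enat d" using dd by (rule order_trans)
      then show False by simp
    qed
    then obtain p where p: "pcas x p y" "set p \<subseteq> parcs T" "length p \<le> d"
      unfolding apath_def awalk_def by auto
    then show ?thesis using walk[OF p(1,2)] tr.reach_mono[OF p(3)] by blast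
  qed
  then show ?thesis unfolding tr.diameter_le_def by blast
qed

section \<open>The circuits of the extremal tournament\<close>

lemma T_nm3_arcD:
  assumes "(i, j) \<in> parcs (T_nm3 n)" "9 \<le> n"
  shows "i < n" "j < n"
    and "j = i + 1 \<or> (i = 0 \<and> j = 2) \<or> (i = n - 3 \<and> j = n - 1) \<or> j + 1 < i"
  using assms by (auto simp: T_nm3_def T_nm1_def reverse_arcs_def)

text \<open>
  Vertex sequences that start at their least vertex. Besides the intervals there is the circuit that
  skips $z_1$ and the one that skips $z_{n-2}$.
\<close>

definition T_nm3_circuits :: "nat \<Rightarrow> nat \<Rightarrow> nat list set" where
  "T_nm3_circuits n l = (\<lambda>m. [m..<m + l]) ` {..n - l} \<union>
     {0 # [2..<l + 1], [n - 1 - l..<n - 2] @ [n - 1]}"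

lemma finite_T_nm3_circuits: "finite (T_nm3_circuits n l)"
  unfolding T_nm3_circuits_def by simp

lemma card_T_nm3_circuits: "card (T_nm3_circuits n l) \<le> n - l + 3"
proof -
  have "card (T_nm3_circuits n l) \<le> card ((\<lambda>m. [m..<m + l]) ` {..n - l}) +
      card {0 # [2..<l + 1], [n - 1 - l..<n - 2] @ [n - 1]}"
    unfolding T_nm3_circuits_def by (rule card_Un_le)
  also have "\<dots> \<le> card {..n - l} + 2"
    by (intro add_mono card_image_le) (simp_all add: card_insert_if)
  finally show ?thesis by simp
qed

text \<open>
  Each arc either goes to the next vertex, skips $z_1$ or $z_{n-2}$, or goes down. Starting at the least
  vertex, a circuit cannot go down before it closes: all lower vertices that are available have been
  visited, except for $z_1$ if it was skipped, and $z_1$ leads only to $z_2$. Hence the sequence is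
  forced, except for the choices at $z_0$ and at $z_{n-3}$.
\<close>

lemma T_nm3_circuit_from_min:
  assumes ys: "circuit (\<lambda>a b. (a, b) \<in> parcs (T_nm3 n)) ys" and len: "length ys = l"
    and min: "\<And>y. y \<in> set ys \<Longrightarrow> hd ys \<le> y" and n: "9 \<le> n" "6 \<le> l" "l \<le> n - 3"
  shows "ys \<in> T_nm3_circuits n l"
proof -
  define a where "a t = ys ! t" for t
  define m where "m = a 0"
  let ?N = "\<lambda>a b. (a, b) \<in> parcs (T_nm3 n)"
  have arc: "?N (a t) (a (t + 1))" if "t + 1 < l" for t
    using ys that successively_nth[of ?N "ys @ [hd ys]" t] len
    unfolding circuit_def a_def by (auto simp: nth_append)
  have close: "?N (a (l - 1)) (a 0)"
    using ys n len unfolding circuit_iff a_def by (auto simp: last_conv_nth hd_conv_nth)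
  have inj: "a s = a t \<longleftrightarrow> s = t" if "s < l" "t < l" for s t
    using ys that len unfolding circuit_def a_def by (simp add: nth_eq_iff_index_eq)
  have low: "m \<le> a t" if "t < l" for t
    using min[of "ys ! t"] that len ys unfolding m_def a_def circuit_def by (simp add: hd_conv_nth)
  have lt: "a t < n" if "t < l" for t
  proof (cases "t + 1 < l")
    case True
    then show ?thesis using T_nm3_arcD(1)[OF arc n(1)] by blast
  next
    case False
    then have "t = l - 1" using that by simp
    then show ?thesis using T_nm3_arcD(1)[OF close n(1)] by simp
  qed
  have eqI: "ys = zs" if "length zs = l" "\<And>t. t < l \<Longrightarrow> a t = zs ! t" for zs
    by (rule nth_equalityI) (use that len a_def in auto)
  have next_step: "a (t + 1) = a t + 1 \<or> (a t = 0 \<and> a (t + 1) = 2) \<or>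
      (a t = n - 3 \<and> a (t + 1) = n - 1) \<or> a (t + 1) + 1 < a t" if "t + 1 < l" for t
    by (rule T_nm3_arcD(3)[OF arc[OF that] n(1)])
  show ?thesis
  proof (cases "a 0 = 0 \<and> a 1 = 2")
    case True
    have run: "1 \<le> s \<Longrightarrow> s < l \<Longrightarrow> a s = s + 1" for s
    proof (induction s rule: less_induct)
      case (less s)
      show ?case
      proof (cases "s = 1")
        case False
        define t where "t = s - 1"
        have t: "s = t + 1" "1 \<le> t" "t < l" using less.prems False unfolding t_def by auto
        have at: "a t = t + 1" using less.IH[of t] t by simp
        have "\<not> a s < t"
        proof
          assume lo: "a s < t"
          consider "a s = 0" | "a s = 1" | "2 \<le> a s" by linarith
          then show False
          proof cases
            case 1
            then show False using inj[of s 0] True less.prems by simp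
          next
            case 2
            show False
            proof (cases "s + 1 < l")
              case t: True
              have "a (s + 1) = 2" using next_step[OF t] 2 n by auto
              then show False using inj[of "s + 1" 1] True t less.prems by simp
            next
              case False
              then have "s = l - 1" using less.prems by simp
              then show False using T_nm3_arcD(3)[OF close n(1)] 2 True n by auto
            qed
          next
            case 3
            have "a (a s - 1) = a s" using less.IH[of "a s - 1"] 3 lo t by simp
            moreover have "a s - 1 < l" "a s - 1 \<noteq> s" using lo t less.prems by linarith+
            ultimately show False using inj[of "a s - 1" s] less.prems by simp
          qed
        qed
        then show ?thesis using next_step[of t] at t less.prems n by auto
      qed (use True in simp)
    qed
    have "ys = 0 # [2..<l + 1]"
    proof (rule eqI)
      show "a t = (0 # [2..<l + 1]) ! t" if "t < l" for t
        using run[of t] that True by (cases t) (auto simp del: upt_Suc)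
    qed (use n in simp)
    then show ?thesis unfolding T_nm3_circuits_def by simp
  next
    case False
    have run: "s < l \<Longrightarrow> m + s \<le> n - 3 \<Longrightarrow> a s = m + s" for s
    proof (induction s rule: less_induct)
      case (less s)
      show ?case
      proof (cases s)
        case (Suc t)
        then have at: "a t = m + t" using less by simp
        have "\<not> a s < a t"
        proof
          assume lo: "a s < a t"
          have "a (a s - m) = a s" using less.IH[of "a s - m"] low[of s] lo at less.prems Suc by simp
          moreover have "a s - m < l" "a s - m \<noteq> s" using low[of s] lo at less.prems Suc by linarith+
          ultimately show False using inj[of "a s - m" s] less.prems by simp
        qed
        moreover have "\<not> (a t = 0 \<and> a (t + 1) = 2)" using False at by (cases t) (auto simp: m_def)
        ultimately show ?thesis using next_step[of t] at less.prems Suc n by auto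
      qed (simp add: m_def)
    qed
    have ml: "m + l \<le> n"
    proof -
      have "set ys \<subseteq> {m..<n}" using low lt len by (auto simp: in_set_conv_nth a_def)
      then have "card (set ys) \<le> n - m" using card_mono[of "{m..<n}" "set ys"] by simp
      moreover have "card (set ys) = l" using ys len distinct_card unfolding circuit_def by metis
      moreover have "m < n" using lt[of 0] n m_def by simp
      ultimately show ?thesis by simp
    qed
    have whole: "ys \<in> T_nm3_circuits n l" if "\<And>t. t < l \<Longrightarrow> a t = m + t"
    proof -
      have "ys = [m..<m + l]" by (rule eqI) (use that in auto)
      then show ?thesis unfolding T_nm3_circuits_def using ml by auto
    qed
    show ?thesis
    proof (cases "m + l \<le> n - 2")
      case True
      show ?thesis by (rule whole) (use run True in auto)
    next
      case big: False
      define s where "s = n - 3 - m"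
      have s: "m + s = n - 3" "s + 1 < l" using big ml n unfolding s_def by auto
      have as: "a s = n - 3" using run[of s] s by simp
      have visited: "\<not> (a t < n - 2)" if "s < t" "t < l" for t
      proof
        assume lo: "a t < n - 2"
        have "a (a t - m) = m + (a t - m)" by (rule run) (use low[of t] lo that s in auto)
        moreover have "a t - m < l" "a t - m \<noteq> t" using low[of t] lo that s by linarith+
        ultimately show False using inj[of "a t - m" t] low[of t] lo that by simp
      qed
      have s1: "a (s + 1) = n - 2 \<or> a (s + 1) = n - 1"
        using visited[of "s + 1"] lt[of "s + 1"] s by linarith
      consider "m + l = n - 1" | "m + l = n" using big ml n by linarith
      then show ?thesis
      proof cases
        case 1
        then have l: "l = s + 2" using s n by simp
        show ?thesis
          using s1
        proof
          assume "a (s + 1) = n - 2"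
          then show ?thesis
            by (intro whole) (use run s l n in \<open>auto simp: less_Suc_eq\<close>)
        next
          assume last: "a (s + 1) = n - 1"
          have "ys = [n - 1 - l..<n - 2] @ [n - 1]"
          proof (rule eqI)
            show "length ([n - 1 - l..<n - 2] @ [n - 1]) = l" using n by auto
            show "a t = ([n - 1 - l..<n - 2] @ [n - 1]) ! t" if "t < l" for t
            proof (cases "t = s + 1")
              case True
              then show ?thesis using last l s n 1 by (auto simp: nth_append)
            next
              case False
              then have "a t = m + t" "t < n - 2 - (n - 1 - l)" using run[of t] that l s n 1 by auto
              moreover have "n - 1 - l = m" using 1 n by simp
              ultimately show ?thesis by (simp add: nth_append)
            qed
          qed
          then show ?thesis unfolding T_nm3_circuits_def by simp
        qed
      next
        case 2
        then have l: "l = s + 3" using s n by simp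
        have s2: "a (s + 2) = n - 2 \<or> a (s + 2) = n - 1"
          using visited[of "s + 2"] lt[of "s + 2"] l by linarith
        have "a (s + 1) \<noteq> n - 1"
        proof
          assume e: "a (s + 1) = n - 1"
          then have "a (s + 2) = n - 2" using s2 inj[of "s + 2" "s + 1"] l by auto
          then show False using next_step[of "s + 1"] e l n by auto
        qed
        then have "a (s + 1) = n - 2" "a (s + 2) = n - 1"
          using s1 s2 inj[of "s + 2" "s + 1"] l by auto
        then show ?thesis
          by (intro whole) (use run s l n in \<open>auto simp: less_Suc_eq numeral_3_eq_3\<close>)
      qed
    qed
  qed
qed

lemma circuit_map:
  assumes "circuit E xs" "inj_on f (set xs)"
    and "\<And>x y. x \<in> set xs \<Longrightarrow> y \<in> set xs \<Longrightarrow> E x y \<Longrightarrow> E' (f x) (f y)"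
  shows "circuit E' (map f xs)"
proof -
  have ne: "xs \<noteq> []" and d: "distinct xs" using assms(1) unfolding circuit_def by auto
  have s: "set (xs @ [hd xs]) = set xs" using ne by auto
  have "successively (\<lambda>x y. E' (f x) (f y)) (xs @ [hd xs])"
    by (rule successively_mono_set[of E]) (use assms s in \<open>auto simp: circuit_def\<close>)
  then have "successively E' (map f (xs @ [hd xs]))" by (simp only: successively_map)
  then show ?thesis unfolding circuit_def using ne d assms(2) by (simp add: distinct_map hd_map)
qed

lemma rotate_to_min:
  fixes xs :: "nat list"
  assumes "circuit E xs"
  shows "\<exists>k. circuit E (rotate k xs) \<and> (\<forall>y\<in>set xs. hd (rotate k xs) \<le> y)"
proof -
  have "xs \<noteq> []" using assms unfolding circuit_def by simp
  then have m: "Min (set xs) \<in> set xs" "\<forall>y\<in>set xs. Min (set xs) \<le> y" by auto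
  then obtain us vs where xs: "xs = us @ Min (set xs) # vs" by (meson split_list)
  have "rotate (length us) (us @ Min (set xs) # vs) = Min (set xs) # vs @ us"
    by (simp add: rotate_append)
  then have r: "rotate (length us) xs = (Min (set xs) # vs) @ us" using xs by simp
  have "circuit E ((Min (set xs) # vs) @ us)" by (rule circuit_rotate) (use assms xs in simp)
  then show ?thesis using m r by (intro exI[of _ "length us"]) auto
qed

lemma num_circuits_T_nm3_iso:
  assumes T: "pair_fin_digraph T" and iso: "digraph_iso (with_proj T) (with_proj (T_nm3 n))"
    and n: "9 \<le> n" "6 \<le> l" "l \<le> n - 3"
  shows "num_circuits l (with_proj T) \<le> n - l + 3"
proof -
  interpret pair_fin_digraph T by fact
  obtain h where h: "digraph_isomorphism h" "with_proj (T_nm3 n) = app_iso h (with_proj T)"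
    using iso unfolding digraph_iso_def by blast
  define f where "f = iso_verts h"
  have "iso_tail h = fst" "iso_head h = snd" "iso_arcs h ` parcs T = parcs (T_nm3 n)"
    using arg_cong[OF h(2), of tail] arg_cong[OF h(2), of head] arg_cong[OF h(2), of arcs]
    by (auto simp: app_iso_def)
  then have arcs: "(f x, f y) \<in> parcs (T_nm3 n)" if "(x, y) \<in> parcs T" for x y
    using h(1) that unfolding digraph_isomorphism_def f_def by force
  have inj: "inj_on f (pverts T)" using h(1) unfolding digraph_isomorphism_def f_def by simp
  let ?g = "inv_into (pverts T) f"
  have "num_circuits l (with_proj T) \<le> card (map ?g ` T_nm3_circuits n l)"
  proof (rule num_circuits_le[OF T])
    fix xs assume xs: "circuit (\<lambda>a b. (a, b) \<in> parcs T) xs" "length xs = l"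
    have V: "set xs \<subseteq> pverts T" using circuit_verts[OF pair_wf_digraph_axioms xs(1)] .
    have "circuit (\<lambda>a b. (a, b) \<in> parcs (T_nm3 n)) (map f xs)"
      by (rule circuit_map[OF xs(1) inj_on_subset[OF inj V]]) (use arcs in blast)
    then obtain k where k: "circuit (\<lambda>a b. (a, b) \<in> parcs (T_nm3 n)) (rotate k (map f xs))"
      "\<forall>y\<in>set (map f xs). hd (rotate k (map f xs)) \<le> y" using rotate_to_min by blast
    then have "rotate k (map f xs) \<in> T_nm3_circuits n l"
      by (intro T_nm3_circuit_from_min[OF k(1)]) (use xs n in auto)
    moreover have "map ?g (map f xs) = xs"
      using V inj by (intro nth_equalityI) (auto intro!: inv_into_f_f)
    then have "rotate k xs = map ?g (rotate k (map f xs))" by (metis rotate_map)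
    ultimately show "\<exists>k. rotate k xs \<in> map ?g ` T_nm3_circuits n l" by blast
  qed (simp add: finite_T_nm3_circuits)
  also have "\<dots> \<le> card (T_nm3_circuits n l)" by (rule card_image_le[OF finite_T_nm3_circuits])
  also have "\<dots> \<le> n - l + 3" by (rule card_T_nm3_circuits)
  finally show ?thesis .
qed

lemma digraph_iso_T_nm3I:
  assumes T: "pair_wf_digraph T" and g: "bij_betw g {..<n} (pverts T)"
    and arcs: "\<And>i j. i < n \<Longrightarrow> j < n \<Longrightarrow> (g i, g j) \<in> parcs T \<longleftrightarrow> (i, j) \<in> parcs (T_nm3 n)"
    and n: "9 \<le> n"
  shows "digraph_iso (with_proj T) (with_proj (T_nm3 n))"
proof -
  interpret pair_wf_digraph T by fact
  define f where "f = inv_into {..<n} g"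
  have f: "bij_betw f (pverts T) {..<n}" unfolding f_def by (rule bij_betw_inv_into[OF g])
  have gf: "g (f x) = x" if "x \<in> pverts T" for x
    using that g unfolding f_def by (metis bij_betw_inv_into_right)
  have fg: "f (g i) = i" if "i < n" for i
    using that g unfolding f_def by (metis bij_betw_inv_into_left lessThan_iff)
  have fn: "f x < n" if "x \<in> pverts T" for x using f that unfolding bij_betw_def by auto
  have gn: "g i \<in> pverts T" if "i < n" for i using g that unfolding bij_betw_def by auto
  let ?F = "\<lambda>a. (f (fst a), f (snd a))"
  let ?h = "\<lparr>iso_verts = f, iso_arcs = ?F, iso_head = snd, iso_tail = fst\<rparr>"
  have "inj_on ?F (parcs T)"
  proof (rule inj_onI)
    fix a b assume ab: "a \<in> parcs T" "b \<in> parcs T" "?F a = ?F b"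
    then have "fst a = fst b" "snd a = snd b"
      using gf arc_fst_in_verts arc_snd_in_verts by (metis prod.inject)+
    then show "a = b" by (rule prod_eqI)
  qed
  then have "digraph_isomorphism ?h"
    unfolding digraph_isomorphism_def using f wf_digraph_axioms by (auto simp: bij_betw_def)
  moreover have "with_proj (T_nm3 n) = app_iso ?h (with_proj T)"
  proof -
    have "f ` pverts T = {..<n}" using f unfolding bij_betw_def by simp
    moreover have "pverts (T_nm3 n) = {..<n}" by (simp add: T_nm3_def T_nm1_def reverse_arcs_def)
    moreover have "?F ` parcs T = parcs (T_nm3 n)"
    proof (intro set_eqI iffI)
      fix e assume "e \<in> ?F ` parcs T"
      then obtain x y where "(x, y) \<in> parcs T" "e = (f x, f y)" by auto
      then show "e \<in> parcs (T_nm3 n)"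
        using arcs[of "f x" "f y"] gf fn in_arcsD1 in_arcsD2 by metis
    next
      fix e assume e: "e \<in> parcs (T_nm3 n)"
      then have ij: "fst e < n" "snd e < n" using T_nm3_arcD(1,2)[of "fst e" "snd e" n] n by auto
      then have "(g (fst e), g (snd e)) \<in> parcs T" using arcs e by auto
      then show "e \<in> ?F ` parcs T"
        by (rule rev_image_eqI) (use fg ij in auto)
    qed
    ultimately show ?thesis by (simp add: app_iso_def with_proj_def)
  qed
  ultimately show ?thesis unfolding digraph_iso_def by blast
qed

lemma twin_ended_iso:
  assumes T: "tournament T" and tr: "tournament_relation E"
    and E: "\<And>x y. x \<in> pverts T \<Longrightarrow> y \<in> pverts T \<Longrightarrow> E x y \<longleftrightarrow> (x, y) \<in> parcs T"
    and te: "tournament_relation.twin_ended E (pverts T)" and n: "card (pverts T) = n" "9 \<le> n"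
  shows "digraph_iso (with_proj T) (with_proj (T_nm3 n))"
proof -
  interpret tournament T by fact
  interpret tr: tournament_relation E by fact
  have "7 \<le> n" using n by simp
  then obtain z v w where z: "tr.path_tournament z (n - 2)"
    and vw: "v \<notin> z ` {..<n - 2}" "w \<notin> z ` {..<n - 2}" "v \<noteq> w"
    and s: "tr.near_start z (n - 2) v" and e: "tr.near_end z (n - 2) w" and wv: "E w v"
    and V: "pverts T = insert v (insert w (z ` {..<n - 2}))" and ends: "E v (z 0)" "E (z (n - 3)) w"
    by (rule tr.twin_ended_coordinates[OF te n(1)])
  define g where "g i = (if i = 0 then v else if i = n - 1 then w else z (i - 1))" for i
  have img: "g ` {..<n} = pverts T"
  proof -
    have "{..<n} = insert 0 (insert (n - 1) (Suc ` {..<n - 2}))"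
    proof (intro set_eqI iffI)
      fix i assume "i \<in> {..<n}"
      then show "i \<in> insert 0 (insert (n - 1) (Suc ` {..<n - 2}))"
        by (cases i) (auto simp: image_iff)
    qed (use n in auto)
    moreover have "g ` Suc ` {..<n - 2} = z ` {..<n - 2}"
      unfolding image_image using n by (intro image_cong) (auto simp: g_def)
    ultimately have "g ` {..<n} = insert (g 0) (insert (g (n - 1)) (z ` {..<n - 2}))"
      by (simp only: image_insert)
    then show ?thesis using V n by (simp add: g_def)
  qed
  have g: "bij_betw g {..<n} (pverts T)"
    unfolding bij_betw_def using img n by (auto intro!: eq_card_imp_inj_on)
  have fwd: "E (g i) (g j)" if N: "(i, j) \<in> parcs (T_nm3 n)" for i j
  proof -
    have ij: "i < n" "j < n"
      and c: "(j = i + 1 \<or> j + 1 < i) \<and> \<not> (i = 2 \<and> j = 0) \<and> \<not> (i = n - 1 \<and> j = n - 3) \<or>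
        i = 0 \<and> j = 2 \<or> i = n - 3 \<and> j = n - 1"
      using N n by (auto simp: T_nm3_def T_nm1_def reverse_arcs_def)
    note st = tr.path_tournamentD(2)[OF z] and bk = tr.path_tournamentD(3)[OF z]
    have ns: "E v (z 1)" "\<And>k. 2 \<le> k \<Longrightarrow> k < n - 2 \<Longrightarrow> E (z k) v"
      using s unfolding tr.near_start_def by auto
    have "n - 2 - 2 = n - 4" by simp
    then have ne: "E (z (n - 4)) w" "\<And>k. k + 2 < n - 2 \<Longrightarrow> E w (z k)"
      using e unfolding tr.near_end_def by auto
    consider "i = 0" | "i = n - 1" | "0 < i" "i < n - 1" using ij by linarith
    then show ?thesis
    proof cases
      case 1
      then have "j = 1 \<or> j = 2" using c n by auto
      then show ?thesis using 1 ends(1) ns(1) n by (auto simp: g_def)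
    next
      case 2
      then have j: "j + 1 < n - 1" "j \<noteq> n - 3" using c n ij by auto
      then show ?thesis using 2 wv ne(2)[of "j - 1"] n by (cases "j = 0") (auto simp: g_def)
    next
      case 3
      then have gi: "g i = z (i - 1)" by (simp add: g_def)
      consider "j = 0" | "j = n - 1" | "0 < j" "j < n - 1" using ij by linarith
      then show ?thesis
      proof cases
        case 1
        then have "3 \<le> i" using c n by auto
        then show ?thesis using 1 3 gi ns(2)[of "i - 1"] by (auto simp: g_def)
      next
        case 2
        then have "i = n - 2 \<or> i = n - 3" using c n ij 3 by auto
        moreover have "n - 2 - 1 = n - 3" "n - 3 - 1 = n - 4" by auto
        ultimately show ?thesis using 2 gi ends(2) ne(1) n by (auto simp: g_def)
      next
        case t: 3
        then have gj: "g j = z (j - 1)" by (simp add: g_def)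
        have "j = i + 1 \<or> j + 1 < i" using c t 3 by auto
        then show ?thesis
        proof
          assume "j = i + 1"
          then show ?thesis using st[of "i - 1"] gi gj 3 t by auto
        next
          assume "j + 1 < i"
          then show ?thesis using bk[of "j - 1" "i - 1"] gi gj 3 t by auto
        qed
      qed
    qed
  qed
  show ?thesis
  proof (rule digraph_iso_T_nm3I[OF pair_wf_digraph_axioms g _ n(2)])
    fix i j assume ij: "i < n" "j < n"
    have V: "g i \<in> pverts T" "g j \<in> pverts T" using img ij by auto
    have n4: "4 \<le> n" using n by simp
    interpret t3: tournament "T_nm3 n" by (rule tournament_T_nm3[OF n4])
    have pv: "pverts (T_nm3 n) = {..<n}" by (simp add: T_nm3_def T_nm1_def reverse_arcs_def)
    show "(g i, g j) \<in> parcs T \<longleftrightarrow> (i, j) \<in> parcs (T_nm3 n)"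
    proof
      assume "(i, j) \<in> parcs (T_nm3 n)"
      then show "(g i, g j) \<in> parcs T" using fwd E[OF V] by simp
    next
      assume "(g i, g j) \<in> parcs T"
      then have e: "E (g i) (g j)" using E[OF V] by simp
      then have "i \<noteq> j" using tr.irrefl by metis
      show "(i, j) \<in> parcs (T_nm3 n)"
      proof (rule ccontr)
        assume "\<not> ?thesis"
        then have "(j, i) \<in> parcs (T_nm3 n)"
          using t3.orientation[of i j] ij pv \<open>i \<noteq> j\<close> by simp
        then show False using fwd e tr.asym by blast
      qed
    qed
  qed
qed

section \<open>Tournaments with diameter at most $n - 3$\<close>

theorem theorem3:
  fixes T :: "'a pair_pre_digraph" and n l :: nat
  assumes "tournament T"
    and "card (pverts T) = n"
    and "n \<ge> 9"
    and "strongly_connected (with_proj T)"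
    and "digraph_diameter (with_proj T) \<le> enat (n - 3)"
    and "6 \<le> l" and "l \<le> n - 3"
  shows "num_circuits l (with_proj T) \<ge> n - l + 3 \<and>
    (num_circuits l (with_proj T) = n - l + 3 \<longleftrightarrow>
      digraph_iso (with_proj T) (with_proj (T_nm3 n)))"
proof -
  interpret tournament T by fact
  obtain E where tr: "tournament_relation E"
    and E: "\<And>x y. x \<in> pverts T \<Longrightarrow> y \<in> pverts T \<Longrightarrow> E x y \<longleftrightarrow> (x, y) \<in> parcs T"
    using extend_to_tournament_relation[OF assms(1)] by blast
  interpret tr: tournament_relation E by (rule tr)
  let ?V = "pverts T"
  have strong: "tr.strong ?V"
    by (rule strongly_connected_strong[OF tr pair_wf_digraph_axioms E assms(4)])
  have diam: "tr.diameter_le ?V (card ?V - 3)"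
    unfolding assms(2) by (rule diameter_reach[OF tr pair_wf_digraph_axioms E assms(5)])
  have "card (tr.strong_sets l ?V) \<le> num_circuits l (with_proj T)"
  proof (rule num_circuits_ge[OF pair_fin_digraph_axioms])
    show "finite (tr.strong_sets l ?V)" by (rule tr.finite_strong_sets[OF pair_finite_verts])
    fix U assume "U \<in> tr.strong_sets l ?V"
    then have U: "U \<subseteq> ?V" "card U = l" "tr.strong U" unfolding tr.strong_sets_def by auto
    then have "finite U" using pair_finite_verts finite_subset by blast
    then obtain xs where xs: "circuit E xs" "set xs = U"
      using tr.strong_hamiltonian[of U] U assms(6) by auto
    have "circuit (\<lambda>a b. (a, b) \<in> parcs T) xs"
      by (rule circuit_cong[OF xs(1)]) (use xs(2) U(1) E in blast)
    moreover have "length xs = l" using xs U(2) distinct_card unfolding circuit_def by metis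
    ultimately show "\<exists>xs. circuit (\<lambda>a b. (a, b) \<in> parcs T) xs \<and> set xs = U \<and> length xs = l"
      using xs(2) by blast
  qed
  moreover have "n - l + 4 \<le> card (tr.strong_sets l ?V) \<or>
      tr.twin_ended ?V \<and> n - l + 3 \<le> card (tr.strong_sets l ?V)"
    using tr.many_strong_sets[OF pair_finite_verts strong diam assms(6)] assms by auto
  moreover have "digraph_iso (with_proj T) (with_proj (T_nm3 n))" if "tr.twin_ended ?V"
    by (rule twin_ended_iso[OF assms(1) tr E that assms(2,3)])
  moreover have "num_circuits l (with_proj T) \<le> n - l + 3"
    if "digraph_iso (with_proj T) (with_proj (T_nm3 n))"
    by (rule num_circuits_T_nm3_iso[OF pair_fin_digraph_axioms that assms(3,6,7)])
  ultimately show ?thesis by linarith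
qed

end
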